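(* There is an absolute constant $C>0$ such that the following holds. Let $\mathbf{A}\in\mathbb{R}^{m\times n}$ be a full-column-rank matrix with no zero rows, let $p>2$, let $\overline{\mathbf{w}}\in\mathbb{R}^m_{>0}$ be the vector of its $\ell_p$-Lewis weights, and let $\varepsilon\in(0,1)$. Then there is an algorithm (the row-wise fixed-point iteration described in the context) which returns $\widehat{\mathbf{w}}\in\mathbb{R}^m_{>0}$ satisfying $$(1-\varepsilon)\overline{w}_i\le\widehat{w}_i\le(1+\varepsilon)\overline{w}_i\qquad\text{for every } i\in[m],$$ using at most $C\,p\log\left(\frac{p\sqrt{m}}{\varepsilon}\right)$ iterations, where each iteration computes all $m$ exact row leverage scores of a matrix $\mathbf{D}\mathbf{A}\in\mathbb{R}^{m\times n}$ with $\mathbf{D}=\operatorname{Diag}(d_1,\ldots,d_m)$ for some positive $d_1,\ldots,d_m$.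
   Context: All computations are in exact real arithmetic. For a full-column-rank matrix $\mathbf{B}$ with rows $\mathbf{b}_j^\top$, the $j$-th leverage score is $\sigma_j(\mathbf{B}):=\mathbf{b}_j^\top(\mathbf{B}^\top\mathbf{B})^{-1}\mathbf{b}_j$. For $\mathbf{w}\in\mathbb{R}^m_{>0}$ write $\mathbf{W}:=\operatorname{Diag}(\mathbf{w})$. The $\ell_p$-Lewis weights of $\mathbf{A}$ are the unique vector $\overline{\mathbf{w}}\in\mathbb{R}^m_{>0}$ satisfying $\overline{w}_i=\sigma_i(\overline{\mathbf{W}}^{1/2-1/p}\mathbf{A})$ for all $i\in[m]$ (existence and uniqueness are known). The algorithm (input: $\mathbf{A}$, $p>2$, $\varepsilon\in(0,1)$). If $m=n$, return $\widehat{w}_i=1$ for all $i$ (no iterations are performed). Otherwise set $w_i^{(0)}:=n/m$ for all $i$ and $N:=\lceil p\log(8p\sqrt{m}/\varepsilon)\rceil$. For $t=0,1,\ldots,N-1$ (one iteration each), compute the exact leverage scores and set $w_i^{(t+1)}:=\sigma_i((\mathbf{W}^{(t)})^{1/2-1/p}\mathbf{A})$ for all $i\in[m]$. Return $$\widehat{w}_i:=\left(\frac{w_i^{(N)}}{(w_i^{(N-1)})^{1-2/p}}\right)^{p/2}\quad\text{for all } i\in[m].$$ *)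

theory Defs
  imports
    Complex_Main
    "Jordan_Normal_Form.DL_Rank"
    "Jordan_Normal_Form.Gauss_Jordan_Elimination"
begin

definition full_column_rank :: "real mat \<Rightarrow> bool" where
  "full_column_rank B \<longleftrightarrow> vec_space.rank (dim_row B) B = dim_col B"

(* Meaningful for full_column_rank B only: there the Gram matrix is invertible, so that
   mat_inverse returns Some. *)
definition leverage_score :: "real mat \<Rightarrow> nat \<Rightarrow> real" where
  "leverage_score B j =
     row B j \<bullet> (the (mat_inverse (transpose_mat B * B)) *\<^sub>v row B j)"

definition leverage_scores :: "real mat \<Rightarrow> real vec" where
  "leverage_scores B = vec (dim_row B) (leverage_score B)"

definition positive_vec :: "real vec \<Rightarrow> bool" where
  "positive_vec v \<longleftrightarrow> (\<forall>i < dim_vec v. 0 < v $ i)"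

definition diag_of_vec :: "real vec \<Rightarrow> real mat" where
  "diag_of_vec d = mat_diag (dim_vec d) (\<lambda>i. d $ i)"

(* The matrix W^(1/2 - 1/p) A with W = Diag(w). *)
definition lewis_rescale :: "real mat \<Rightarrow> real \<Rightarrow> real vec \<Rightarrow> real mat" where
  "lewis_rescale A p w = diag_of_vec (map_vec (\<lambda>x. x powr (1/2 - 1/p)) w) * A"

definition is_lewis_weights :: "real mat \<Rightarrow> real \<Rightarrow> real vec \<Rightarrow> bool" where
  "is_lewis_weights A p w \<longleftrightarrow>
     w \<in> carrier_vec (dim_row A) \<and> positive_vec w \<and>
     (\<forall>i < dim_row A. w $ i = leverage_score (lewis_rescale A p w) i)"

(* The state after t iterations: the iterate w^(t), together with a log that holds, for each
   iteration performed and in order, the matrix whose leverage scores were computed and the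
   computed scores. *)
primrec lewis_run :: "real mat \<Rightarrow> real \<Rightarrow> nat \<Rightarrow> real vec \<times> (real mat \<times> real vec) list" where
  "lewis_run A p 0 = (vec (dim_row A) (\<lambda>i. real (dim_col A) / real (dim_row A)), [])"
| "lewis_run A p (Suc t) =
     (let (w, iters) = lewis_run A p t;
          B = lewis_rescale A p w;
          w' = leverage_scores B
      in (w', iters @ [(B, w')]))"

(* Returns the approximate weights and the log of the iterations that were performed.
   In the second branch the number of iterations N is positive whenever p > 2 and
   0 < eps < 1, so N - 1 is not truncated. *)
definition lewis_fixed_point ::
    "real mat \<Rightarrow> real \<Rightarrow> real \<Rightarrow> real vec \<times> (real mat \<times> real vec) list" where
  "lewis_fixed_point A p \<epsilon> =
     (let m = dim_row A; n = dim_col A in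
      if m = n then (vec m (\<lambda>i. 1), [])
      else
        let N = nat \<lceil>p * ln (8 * p * sqrt (real m) / \<epsilon>)\<rceil>;
            (wN, iters) = lewis_run A p N;
            wprev = fst (lewis_run A p (N - 1))
        in (vec m (\<lambda>i. (wN $ i / (wprev $ i) powr (1 - 2/p)) powr (p/2)), iters))"

end

theory Submission
  imports Defs "Jordan_Normal_Form.Char_Poly"
begin

text \<open>
  Write \<open>\<alpha> = 1 - 2/p\<close>, \<open>M(w) = A\<^sup>T W\<^sup>\<alpha> A\<close> and \<open>\<tau>\<^sub>i(w) = a\<^sub>i\<^sup>T M(w)\<^sup>-\<^sup>1 a\<^sub>i\<close>, so that one iteration is
  \<open>w' = w\<^sup>\<alpha> \<tau>(w)\<close>. Reduce \<open>M(w\<^sup>*)\<close>, for the Lewis weights \<open>w\<^sup>*\<close>, to the identity and \<open>M(w)\<close> to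
  \<open>diag(\<lambda>)\<close> simultaneously. Jensen's inequality in that basis gives
  \<open>KL(w\<^sup>* || w') \<le> \<alpha> KL(w\<^sup>* || w) + \<Sum> ln \<lambda>\<^sub>k\<close>, while weighted AM-GM gives \<open>\<Sum> \<lambda>\<^sub>k \<le> n\<close>, hence
  \<open>\<Sum> ln \<lambda>\<^sub>k \<le> 0\<close>. So the divergence contracts by the factor \<open>\<alpha> \<le> exp(-2/p)\<close> in every iteration,
  starting from at most \<open>m\<close>. Since the divergence of \<open>w'\<close> is nonnegative, it also bounds the
  log-determinant gap \<open>- \<Sum> ln \<lambda>\<^sub>k\<close>, and together with \<open>\<Sum> \<lambda>\<^sub>k \<le> n\<close> this forces every \<open>\<lambda>\<^sub>k\<close> close
  to 1. Then \<open>\<tau>\<^sub>i(w)\<close> is close to \<open>\<tau>\<^sub>i(w\<^sup>*)\<close>, whose power \<open>p/2\<close> is the Lewis weight.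
\<close>

section \<open>Simultaneous diagonalization of quadratic forms\<close>

definition pos_def_mat :: "real mat \<Rightarrow> bool" where
  "pos_def_mat S \<longleftrightarrow> square_mat S \<and> transpose_mat S = S \<and>
     (\<forall>x \<in> carrier_vec (dim_row S). x \<noteq> 0\<^sub>v (dim_row S) \<longrightarrow> 0 < x \<bullet> (S *\<^sub>v x))"

lemma symmetric_mat_scalar_prod:
  fixes S :: "real mat"
  assumes "S \<in> carrier_mat n n" "transpose_mat S = S" "x \<in> carrier_vec n" "y \<in> carrier_vec n"
  shows "x \<bullet> (S *\<^sub>v y) = y \<bullet> (S *\<^sub>v x)"
  using transpose_vec_mult_scalar[OF assms(1) assms(4,3)] assms
  by (metis comm_scalar_prod mult_mat_vec_carrier)

text \<open>A kernel vector would have quadratic form 0. The conclusion goes through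
  \<open>mat_inverse\<close> because \<open>leverage_score\<close> is defined by it.\<close>

lemma pos_def_mat_invertible:
  assumes S: "S \<in> carrier_mat n n" and "pos_def_mat S"
  obtains R where "mat_inverse S = Some R" "R \<in> carrier_mat n n" "S * R = 1\<^sub>m n" "R * S = 1\<^sub>m n"
proof -
  have "det S \<noteq> 0"
  proof
    assume "det S = 0"
    then obtain x where "x \<in> carrier_vec n" "x \<noteq> 0\<^sub>v n" "S *\<^sub>v x = 0\<^sub>v n"
      using det_0_iff_vec_prod_zero_field[OF S] by blast
    then show False using assms unfolding pos_def_mat_def by auto
  qed
  then have "S \<in> Units (ring_mat TYPE(real) n ())"
    by (rule det_non_zero_imp_unit[OF S])
  then obtain R where "mat_inverse S = Some R"
    using mat_inverse(1)[OF S, where b = "()"] by (cases "mat_inverse S") auto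
  then show ?thesis using that mat_inverse(2)[OF S] by blast
qed

text \<open>By the fundamental theorem of algebra the real matrix \<open>R * T\<close>, with
  \<open>R\<close> the inverse of \<open>S\<close>, has a complex eigenvalue \<open>z\<close>. As
  \<open>T\<close> and \<open>S\<close> are symmetric and \<open>S\<close> is positive definite,
  \<open>z\<close> is real, so the real or the imaginary part of the eigenvector can be taken as
  \<open>v\<close>, once scaled to \<open>S\<close>-norm 1.\<close>

lemma generalized_eigenvector_exists:
  assumes S: "S \<in> carrier_mat n n" and pd: "pos_def_mat S"
    and T: "T \<in> carrier_mat n n" and sT: "transpose_mat T = T" and n: "0 < n"
  obtains v l where "v \<in> carrier_vec n" "v \<bullet> (S *\<^sub>v v) = 1" "T *\<^sub>v v = l \<cdot>\<^sub>v (S *\<^sub>v v)"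
proof -
  obtain R where R: "R \<in> carrier_mat n n" and SR: "S * R = 1\<^sub>m n" and RS: "R * S = 1\<^sub>m n"
    using pos_def_mat_invertible[OF S pd] by metis
  have sS: "transpose_mat S = S" using pd unfolding pos_def_mat_def by blast
  define G where "G = R * T"
  have G: "G \<in> carrier_mat n n" using R T by (simp add: G_def)
  have SG: "S *\<^sub>v (G *\<^sub>v x) = T *\<^sub>v x" if "x \<in> carrier_vec n" for x
  proof -
    have "S *\<^sub>v (G *\<^sub>v x) = (S * G) *\<^sub>v x" using S G that by simp
    also have "S * G = (S * R) * T" using S R T unfolding G_def by (simp add: assoc_mult_mat)
    also have "\<dots> = T" using T SR by simp
    finally show ?thesis .
  qed
  interpret h: inj_comm_ring_hom "complex_of_real" by standard auto
  define Gc where "Gc = map_mat complex_of_real G"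
  have Gc: "Gc \<in> carrier_mat n n" using G by (simp add: Gc_def)
  have "degree (char_poly Gc) = n" using degree_monic_char_poly[OF Gc] by blast
  then obtain z where z: "poly (char_poly Gc) z = 0"
    using fundamental_theorem_of_algebra[of "char_poly Gc"] n constant_degree
    by (metis less_not_refl)
  then have "eigenvalue Gc z" using eigenvalue_root_char_poly[OF Gc] by blast
  then obtain q where q: "q \<in> carrier_vec n" "q \<noteq> 0\<^sub>v n" "Gc *\<^sub>v q = z \<cdot>\<^sub>v q"
    using Gc unfolding eigenvalue_def eigenvector_def by auto
  define x where "x = map_vec Re q"
  define y where "y = map_vec Im q"
  have x: "x \<in> carrier_vec n" and y: "y \<in> carrier_vec n" using q by (auto simp: x_def y_def)
  have ent: "(\<Sum>j<n. complex_of_real (G $$ (i,j)) * q $ j) = z * q $ i" if "i < n" for i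
  proof -
    have "(Gc *\<^sub>v q) $ i = (\<Sum>j<n. complex_of_real (G $$ (i,j)) * q $ j)"
      using that q(1) G unfolding Gc_def by (auto simp: scalar_prod_def lessThan_atLeast0 intro!: sum.cong)
    then show ?thesis using q that by simp
  qed
  \<comment> \<open>\<open>G\<close> is real, so \<open>G q = z q\<close> splits into its real part,
    here, and its imaginary part \<open>Gy\<close>.\<close>
  have Gx: "G *\<^sub>v x = Re z \<cdot>\<^sub>v x - Im z \<cdot>\<^sub>v y"
  proof (rule eq_vecI)
    fix i assume "i < dim_vec (Re z \<cdot>\<^sub>v x - Im z \<cdot>\<^sub>v y)"
    then have i: "i < n" using x y by simp
    have "(G *\<^sub>v x) $ i = (\<Sum>j<n. G $$ (i,j) * Re (q $ j))"
      using i q(1) G unfolding x_def by (auto simp: scalar_prod_def lessThan_atLeast0 intro!: sum.cong)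
    also have "\<dots> = Re (\<Sum>j<n. complex_of_real (G $$ (i,j)) * q $ j)" by simp
    also have "\<dots> = Re (z * q $ i)" using ent[OF i] by simp
    finally show "(G *\<^sub>v x) $ i = (Re z \<cdot>\<^sub>v x - Im z \<cdot>\<^sub>v y) $ i"
      using i q(1) by (simp add: x_def y_def)
  qed (use G x y in auto)
  have Gy: "G *\<^sub>v y = Im z \<cdot>\<^sub>v x + Re z \<cdot>\<^sub>v y"
  proof (rule eq_vecI)
    fix i assume "i < dim_vec (Im z \<cdot>\<^sub>v x + Re z \<cdot>\<^sub>v y)"
    then have i: "i < n" using x y by simp
    have "(G *\<^sub>v y) $ i = (\<Sum>j<n. G $$ (i,j) * Im (q $ j))"
      using i q(1) G unfolding y_def by (auto simp: scalar_prod_def lessThan_atLeast0 intro!: sum.cong)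
    also have "\<dots> = Im (\<Sum>j<n. complex_of_real (G $$ (i,j)) * q $ j)" by simp
    also have "\<dots> = Im (z * q $ i)" using ent[OF i] by simp
    finally show "(G *\<^sub>v y) $ i = (Im z \<cdot>\<^sub>v x + Re z \<cdot>\<^sub>v y) $ i"
      using i q(1) by (simp add: x_def y_def)
  qed (use G x y in auto)
  have Sx: "S *\<^sub>v x \<in> carrier_vec n" and Sy: "S *\<^sub>v y \<in> carrier_vec n" using S x y by auto
  have Tx: "T *\<^sub>v x = Re z \<cdot>\<^sub>v (S *\<^sub>v x) - Im z \<cdot>\<^sub>v (S *\<^sub>v y)"
    unfolding SG[OF x, symmetric] Gx using S x y
    by (simp add: mult_minus_distrib_mat_vec mult_mat_vec)
  have Ty: "T *\<^sub>v y = Im z \<cdot>\<^sub>v (S *\<^sub>v x) + Re z \<cdot>\<^sub>v (S *\<^sub>v y)"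
    unfolding SG[OF y, symmetric] Gy using S x y
    by (simp add: mult_add_distrib_mat_vec mult_mat_vec)
  \<comment> \<open>Symmetry of \<open>T\<close> and \<open>S\<close> forces the imaginary part of the eigenvalue to vanish.\<close>
  have sym: "y \<bullet> (T *\<^sub>v x) = x \<bullet> (T *\<^sub>v y)" using symmetric_mat_scalar_prod[OF T sT y x] .
  have "y \<bullet> (T *\<^sub>v x) = Re z * (y \<bullet> (S *\<^sub>v x)) - Im z * (y \<bullet> (S *\<^sub>v y))"
    unfolding Tx using Sx Sy y by (simp add: scalar_prod_minus_distrib)
  moreover have "x \<bullet> (T *\<^sub>v y) = Im z * (x \<bullet> (S *\<^sub>v x)) + Re z * (x \<bullet> (S *\<^sub>v y))"
    unfolding Ty using Sx Sy x by (simp add: scalar_prod_add_distrib)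
  ultimately have b0: "Im z * (x \<bullet> (S *\<^sub>v x) + y \<bullet> (S *\<^sub>v y)) = 0"
    using sym symmetric_mat_scalar_prod[OF S sS y x] by (simp add: algebra_simps)
  have nn: "0 \<le> u \<bullet> (S *\<^sub>v u)" if "u \<in> carrier_vec n" for u
    using pd S that unfolding pos_def_mat_def by (cases "u = 0\<^sub>v n") (auto simp: less_imp_le)
  have "x \<noteq> 0\<^sub>v n \<or> y \<noteq> 0\<^sub>v n"
  proof (rule ccontr)
    assume "\<not> ?thesis"
    then have "x = 0\<^sub>v n" "y = 0\<^sub>v n" by auto
    then have "Re (q $ i) = 0 \<and> Im (q $ i) = 0" if "i < n" for i
      using that q(1) unfolding x_def y_def by (metis carrier_vecD index_map_vec(1) index_zero_vec(1))
    then have "q = 0\<^sub>v n" using q(1) by (intro eq_vecI) (auto simp: complex_eq_iff)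
    then show False using q(2) by simp
  qed
  then obtain u where u: "u \<in> carrier_vec n" "u \<noteq> 0\<^sub>v n" "u = x \<or> u = y" using x y by blast
  then have us: "0 < u \<bullet> (S *\<^sub>v u)" using pd S unfolding pos_def_mat_def by auto
  have "0 < x \<bullet> (S *\<^sub>v x) + y \<bullet> (S *\<^sub>v y)"
    using us u(3) nn[OF x] nn[OF y] by auto
  then have "Im z = 0" using b0 by simp
  then have Tu: "T *\<^sub>v u = Re z \<cdot>\<^sub>v (S *\<^sub>v u)"
    using u(3) Tx Ty Sx Sy by (auto intro!: eq_vecI)
  define c where "c = 1 / sqrt (u \<bullet> (S *\<^sub>v u))"
  have c2: "c * (c * (u \<bullet> (S *\<^sub>v u))) = 1"
    using us unfolding c_def by (simp add: field_simps)
  show thesis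
  proof (rule that[of "c \<cdot>\<^sub>v u" "Re z"])
    show "c \<cdot>\<^sub>v u \<in> carrier_vec n" using u by simp
    have Su: "S *\<^sub>v u \<in> carrier_vec n" using S u by simp
    show "(c \<cdot>\<^sub>v u) \<bullet> (S *\<^sub>v (c \<cdot>\<^sub>v u)) = 1"
      using c2 Su u S by (simp add: mult_mat_vec)
    show "T *\<^sub>v (c \<cdot>\<^sub>v u) = Re z \<cdot>\<^sub>v (S *\<^sub>v (c \<cdot>\<^sub>v u))"
      using mult_mat_vec[OF T u(1)] mult_mat_vec[OF S u(1)] Tu
      by (simp add: smult_smult_assoc mult.commute)
  qed
qed

text \<open>Induction on the dimension. For a generalized eigenvector \<open>v\<close>, the
  \<open>S\<close>-orthogonal complement of \<open>v\<close> is also \<open>T\<close>-orthogonal to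
  \<open>v\<close>, because \<open>T v\<close> is a multiple of \<open>S v\<close>. Both forms
  therefore split, and the induction hypothesis applies to the complement.\<close>

lemma simultaneous_diagonalization:
  assumes "S \<in> carrier_mat n n" "pos_def_mat S" "T \<in> carrier_mat n n" "transpose_mat T = T"
  shows "\<exists>P \<in> carrier_mat n n. \<exists>l. transpose_mat P * S * P = 1\<^sub>m n \<and>
    transpose_mat P * T * P = mat_diag n l"
  using assms
proof (induction n arbitrary: S T)
  case 0
  then show ?case
    by (intro bexI[of _ "0\<^sub>m 0 0"] exI[of _ "\<lambda>_. 0"]) (auto simp: mat_diag_def)
next
  case (Suc n)
  let ?N = "Suc n"
  note S = Suc.prems(1) and pd = Suc.prems(2) and T = Suc.prems(3) and sT = Suc.prems(4)
  have sS: "transpose_mat S = S" using pd unfolding pos_def_mat_def by blast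
  obtain v l where v: "v \<in> carrier_vec ?N" and v1: "v \<bullet> (S *\<^sub>v v) = 1"
    and Tv: "T *\<^sub>v v = l \<cdot>\<^sub>v (S *\<^sub>v v)"
    using generalized_eigenvector_exists[OF S pd T sT] by blast
  have "\<exists>k<?N. v $ k \<noteq> 0"
  proof (rule ccontr)
    assume "\<not> ?thesis"
    then have "v = 0\<^sub>v ?N" using v by (intro eq_vecI) auto
    then show False using v1 S by simp
  qed
  then obtain k where k: "k < ?N" "v $ k \<noteq> 0" by blast
  \<comment> \<open>The columns of \<open>W\<close> are \<open>v\<close> and the unit vectors other than the \<open>k\<close>-th, each made
    \<open>S\<close>-orthogonal to \<open>v\<close>; hence \<open>W\<close> splits off a 1x1 block of both forms.\<close>
  define e where "e j = (if j < k then j else Suc j)" for j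
  have eN: "e j < ?N" if "j < n" for j using that by (auto simp: e_def)
  have ek: "e j \<noteq> k" for j by (auto simp: e_def)
  have einj: "e i = e j \<longleftrightarrow> i = j" for i j by (auto simp: e_def split: if_splits)
  define Sv where "Sv = S *\<^sub>v v"
  have Sv: "Sv \<in> carrier_vec ?N" using S v by (simp add: Sv_def)
  define f where "f j = (if j = 0 then v else unit_vec ?N (e (j - 1)) - Sv $ e (j - 1) \<cdot>\<^sub>v v)" for j
  have f: "f j \<in> carrier_vec ?N" for j using v by (simp add: f_def)
  define W where "W = mat ?N ?N (\<lambda>(i,j). f j $ i)"
  have W: "W \<in> carrier_mat ?N ?N" by (simp add: W_def)
  have colW: "col W j = f j" if "j < ?N" for j
    using that f[of j] by (intro eq_vecI) (auto simp: W_def)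
  have fSv: "f j \<bullet> Sv = (if j = 0 then 1 else 0)" if "j < ?N" for j
  proof (cases "j = 0")
    case True then show ?thesis using v1 by (simp add: f_def Sv_def)
  next
    case False
    then have "e (j - 1) < ?N" using eN that by auto
    then show ?thesis using False v Sv v1
      by (simp add: f_def minus_scalar_prod_distrib[of _ ?N] Sv_def[symmetric])
  qed
  have conj: "(transpose_mat W * X * W) $$ (i,j) = f i \<bullet> (X *\<^sub>v f j)"
    if X: "X \<in> carrier_mat ?N ?N" and "i < ?N" "j < ?N" for X :: "real mat" and i j
  proof -
    have "transpose_mat W * X * W = transpose_mat W * (X * W)" using W X by (simp add: assoc_mult_mat)
    then have "(transpose_mat W * X * W) $$ (i,j) = row (transpose_mat W) i \<bullet> col (X * W) j"
      using W X that by simp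
    also have "row (transpose_mat W) i = f i" using W that(2) colW by simp
    also have "col (X * W) j = X *\<^sub>v f j" using col_mult2[OF X W that(3)] colW[OF that(3)] by simp
    finally show ?thesis .
  qed
  \<comment> \<open>\<open>W x\<close> is \<open>c v\<close> plus a combination of the unit vectors
    at the indices \<open>e j\<close>. Row \<open>k\<close> sees only \<open>c v\<close>, which
    forces \<open>c = 0\<close>; the rows \<open>e j\<close> then give the remaining
    coordinates.\<close>
  have W_inj: "x = 0\<^sub>v ?N" if x: "x \<in> carrier_vec ?N" and Wx: "W *\<^sub>v x = 0\<^sub>v ?N" for x
  proof -
    define c where "c = x $ 0 - (\<Sum>j<n. Sv $ e j * x $ Suc j)"
    have ent: "(W *\<^sub>v x) $ i = c * v $ i + (\<Sum>j<n. (if i = e j then x $ Suc j else 0))" if "i < ?N" for i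
    proof -
      have "(W *\<^sub>v x) $ i = (\<Sum>j<?N. f j $ i * x $ j)"
        using that x W by (auto simp: scalar_prod_def W_def lessThan_atLeast0 intro!: sum.cong)
      also have "\<dots> = v $ i * x $ 0 + (\<Sum>j<n. f (Suc j) $ i * x $ Suc j)"
        by (subst sum.lessThan_Suc_shift) (simp add: f_def)
      also have "(\<Sum>j<n. f (Suc j) $ i * x $ Suc j)
        = (\<Sum>j<n. (if i = e j then x $ Suc j else 0) - Sv $ e j * x $ Suc j * v $ i)"
        using that v eN by (intro sum.cong) (auto simp: f_def algebra_simps)
      finally show ?thesis
        by (simp add: c_def sum_subtractf algebra_simps sum_distrib_left)
    qed
    have "c * v $ k = 0" using ent[OF k(1)] Wx k(1) ek by (simp add: eq_commute[of k])
    then have c0: "c = 0" using k(2) by simp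
    have xS: "x $ Suc j = 0" if "j < n" for j
      using ent[OF eN[OF that]] Wx eN[OF that] c0 that by (simp add: einj)
    then have "x $ 0 = 0" using c0 by (simp add: c_def)
    then show ?thesis using xS x by (intro eq_vecI) (auto simp: less_Suc_eq_0_disj)
  qed
  \<comment> \<open>The first column of the transformed form consists of the products of
    \<open>f i\<close> with \<open>X v = a Sv\<close>, and all but the first vanish by
    \<open>fSv\<close>. It is used for \<open>S\<close> with \<open>a = 1\<close> and for
    \<open>T\<close> with \<open>a = l\<close>.\<close>
  have block: "\<exists>Y \<in> carrier_mat n n. transpose_mat Y = Y \<and>
      transpose_mat W * X * W = four_block_mat (mat 1 1 (\<lambda>_. a)) (0\<^sub>m 1 n) (0\<^sub>m n 1) Y"
    if X: "X \<in> carrier_mat ?N ?N" and sX: "transpose_mat X = X" and Xv: "X *\<^sub>v v = a \<cdot>\<^sub>v Sv"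
    for X :: "real mat" and a
  proof -
    define Z where "Z = transpose_mat W * X * W"
    have Z: "Z \<in> carrier_mat ?N ?N" using W X by (simp add: Z_def)
    have sZ: "Z $$ (i,j) = Z $$ (j,i)" if "i < ?N" "j < ?N" for i j
      using conj[OF X that] conj[OF X that(2,1)] symmetric_mat_scalar_prod[OF X sX f f]
      by (simp add: Z_def)
    have Z0: "Z $$ (i,0) = (if i = 0 then a else 0)" if "i < ?N" for i
    proof -
      have "Z $$ (i,0) = f i \<bullet> (X *\<^sub>v v)" using conj[OF X that] by (simp add: Z_def f_def[of 0])
      also have "\<dots> = a * (f i \<bullet> Sv)" using Xv f Sv by simp
      finally show ?thesis using fSv[OF that] by simp
    qed
    define Y where "Y = mat n n (\<lambda>(i,j). Z $$ (Suc i, Suc j))"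
    have "transpose_mat Y = Y" using sZ by (intro eq_matI) (auto simp: Y_def)
    moreover have "Z = four_block_mat (mat 1 1 (\<lambda>_. a)) (0\<^sub>m 1 n) (0\<^sub>m n 1) Y"
      using Z Z0 sZ[of 0] by (intro eq_matI) (auto simp: Y_def less_Suc_eq_0_disj)
    moreover have "Y \<in> carrier_mat n n" by (simp add: Y_def)
    ultimately show ?thesis unfolding Z_def by blast
  qed
  obtain S' where S': "S' \<in> carrier_mat n n" "transpose_mat S' = S'"
    and WSW: "transpose_mat W * S * W = four_block_mat (mat 1 1 (\<lambda>_. 1)) (0\<^sub>m 1 n) (0\<^sub>m n 1) S'"
    using block[OF S sS, of 1] Sv by (auto simp: Sv_def)
  obtain T' where T': "T' \<in> carrier_mat n n" "transpose_mat T' = T'"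
    and WTW: "transpose_mat W * T * W = four_block_mat (mat 1 1 (\<lambda>_. l)) (0\<^sub>m 1 n) (0\<^sub>m n 1) T'"
    using block[OF T sT, of l] Tv by (auto simp: Sv_def)
  have pd': "pos_def_mat S'"
    unfolding pos_def_mat_def
  proof (intro conjI ballI impI)
    show "square_mat S'" using S' by simp
    show "transpose_mat S' = S'" by (rule S')
    fix x :: "real vec" assume "x \<in> carrier_vec (dim_row S')" "x \<noteq> 0\<^sub>v (dim_row S')"
    then have x: "x \<in> carrier_vec n" "x \<noteq> 0\<^sub>v n" using S' by auto
    \<comment> \<open>Padding with a leading zero makes the form of \<open>S'\<close> at
      \<open>x\<close> the form of \<open>S\<close> at \<open>W x'\<close>, and \<open>W x'\<close>
      is nonzero by \<open>W_inj\<close>.\<close>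
    define x' where "x' = 0\<^sub>v 1 @\<^sub>v x"
    have x': "x' \<in> carrier_vec ?N" using x(1) by (intro carrier_vecI) (simp add: x'_def)
    have "x' \<noteq> 0\<^sub>v ?N"
    proof
      assume "x' = 0\<^sub>v ?N"
      then have x0: "x' $ Suc i = 0" if "i < n" for i using that by simp
      have "x $ i = 0" if "i < n" for i using x0[OF that] that carrier_vecD[OF x(1)] by (simp add: x'_def)
      then have "x = 0\<^sub>v n" using carrier_vecD[OF x(1)] by (intro eq_vecI) auto
      then show False using x(2) by blast
    qed
    then have Wx: "W *\<^sub>v x' \<noteq> 0\<^sub>v ?N" using W_inj x' by blast
    have "0 < (W *\<^sub>v x') \<bullet> (S *\<^sub>v (W *\<^sub>v x'))"
      using pd Wx W S x' unfolding pos_def_mat_def by auto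
    also have "\<dots> = x' \<bullet> (transpose_mat W *\<^sub>v (S *\<^sub>v (W *\<^sub>v x')))"
      using transpose_vec_mult_scalar[OF W x', of "S *\<^sub>v (W *\<^sub>v x')"] W S x'
      by (metis comm_scalar_prod mult_mat_vec_carrier transpose_carrier_mat)
    also have "transpose_mat W *\<^sub>v (S *\<^sub>v (W *\<^sub>v x')) = (transpose_mat W * S * W) *\<^sub>v x'"
      using W S x' by (simp add: assoc_mult_mat_vec[of _ ?N ?N _ ?N])
    also have "\<dots> = 0\<^sub>v 1 @\<^sub>v (S' *\<^sub>v x)"
    proof -
      have "mat 1 1 (\<lambda>_. 1) *\<^sub>v 0\<^sub>v 1 + 0\<^sub>m 1 n *\<^sub>v x = 0\<^sub>v 1"
        using x by (intro eq_vecI) (auto simp: scalar_prod_def)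
      moreover have "0\<^sub>m n 1 *\<^sub>v 0\<^sub>v 1 + S' *\<^sub>v x = S' *\<^sub>v x"
        using x S' by (intro eq_vecI) (auto simp: scalar_prod_def)
      ultimately show ?thesis
        unfolding WSW x'_def using x S'
        by (subst four_block_mat_mult_vec[of _ 1 1 _ n _ n]) auto
    qed
    also have "x' \<bullet> \<dots> = x \<bullet> (S' *\<^sub>v x)"
      unfolding x'_def using x S' by (subst scalar_prod_append[of _ 1 _ n]) auto
    finally show "0 < x \<bullet> (S' *\<^sub>v x)" .
  qed
  obtain P' l' where P': "P' \<in> carrier_mat n n" "transpose_mat P' * S' * P' = 1\<^sub>m n"
    "transpose_mat P' * T' * P' = mat_diag n l'"
    using Suc.IH[OF S'(1) pd' T'] by blast
  \<comment> \<open>\<open>Q\<close> leaves the split-off 1x1 block alone and diagonalizes the rest,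
    so \<open>W * Q\<close> is the required congruence.\<close>
  define Q where "Q = four_block_mat (1\<^sub>m 1) (0\<^sub>m 1 n) (0\<^sub>m n 1) P'"
  have Q: "Q \<in> carrier_mat ?N ?N"
    using four_block_carrier_mat[OF one_carrier_mat[of 1] P'(1)] by (simp add: Q_def)
  have tQ: "transpose_mat Q = four_block_mat (1\<^sub>m 1) (0\<^sub>m 1 n) (0\<^sub>m n 1) (transpose_mat P')"
    unfolding Q_def using P' by (subst transpose_four_block_mat[of _ 1 1 _ n _ n]) auto
  have conjQ: "transpose_mat Q * four_block_mat D (0\<^sub>m 1 n) (0\<^sub>m n 1) Y * Q
      = four_block_mat D (0\<^sub>m 1 n) (0\<^sub>m n 1) (transpose_mat P' * Y * P')"
    if "Y \<in> carrier_mat n n" "D \<in> carrier_mat 1 1" for D Y :: "real mat"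
    unfolding tQ unfolding Q_def using that P'
    by (subst mult_four_block_mat[of _ 1 1 _ n _ n _ _ 1 _ n], simp_all,
        subst mult_four_block_mat[of _ "Suc 0" "Suc 0" _ n _ n _ _ "Suc 0" _ n], simp_all)
  have assoc: "transpose_mat (W * Q) * X * (W * Q) = transpose_mat Q * (transpose_mat W * X * W) * Q"
    if "X \<in> carrier_mat ?N ?N" for X :: "real mat"
    using W Q that by (simp add: transpose_mult[of _ ?N ?N _ ?N] assoc_mult_mat[of _ ?N ?N _ ?N _ ?N])
  show ?case
  proof (intro bexI[of _ "W * Q"] exI[of _ "\<lambda>i. if i = 0 then l else l' (i - 1)"] conjI)
    show "transpose_mat (W * Q) * S * (W * Q) = 1\<^sub>m ?N"
      unfolding assoc[OF S] WSW using conjQ[OF S'(1)] P'(2)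
      by (simp, intro eq_matI) auto
    show "transpose_mat (W * Q) * T * (W * Q) = mat_diag ?N (\<lambda>i. if i = 0 then l else l' (i - 1))"
      unfolding assoc[OF T] WTW using conjQ[OF T'(1)] P'(3)
      by (simp, intro eq_matI) (auto simp: mat_diag_def)
    show "W * Q \<in> carrier_mat ?N ?N" using W Q by simp
  qed
qed

section \<open>Leverage scores\<close>

text \<open>Linear independence speaks of the set of columns, so equal columns must be excluded
  before it can rule out kernel vectors. The rank is the size of a maximal independent set of
  columns, hence at most the number of different columns.\<close>

lemma (in vec_space) full_rank_distinct_cols:
  assumes A: "A \<in> carrier_mat n nc" and "rank A = nc"
  shows "distinct (cols A)"
proof -
  obtain S where S: "maximal S (\<lambda>T. T \<subseteq> set (cols A) \<and> lin_indpt T)"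
    using maximal_exists[of "(\<lambda>T. T \<subseteq> set (cols A) \<and> lin_indpt T)" "card (set (cols A))" "{}"]
    by (meson List.finite_set card_mono empty_iff empty_subsetI finite_lin_indpt2 rev_finite_subset)
  then have "card S \<le> card (set (cols A))" by (simp add: card_mono maximal_def)
  then have "length (cols A) \<le> card (set (cols A))"
    using rank_card_indpt[OF A S] assms by simp
  then show ?thesis using card_length[of "cols A"] by (intro card_distinct) simp
qed

lemma full_column_rank_kernel:
  assumes A: "A \<in> carrier_mat m n" and "full_column_rank A"
    and x: "x \<in> carrier_vec n" and "A *\<^sub>v x = 0\<^sub>v m"
  shows "x = 0\<^sub>v n"
proof (rule ccontr)
  assume "x \<noteq> 0\<^sub>v n"
  have rank: "vec_space.rank m A = n" using assms(1,2) by (simp add: full_column_rank_def)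
  have dist: "distinct (cols A)" by (rule vec_space.full_rank_distinct_cols[OF A rank])
  show False
    using vec_space.lin_depI[OF A x \<open>x \<noteq> 0\<^sub>v n\<close> assms(4) dist]
      vec_space.full_rank_lin_indpt[OF A rank dist] by blast
qed

section \<open>Gram matrices and positive diagonal scalings\<close>

lemma scalar_prod_self_pos:
  fixes x :: "real vec"
  assumes "x \<noteq> 0\<^sub>v (dim_vec x)"
  shows "0 < x \<bullet> x"
proof -
  obtain i where "i < dim_vec x" "x $ i \<noteq> 0" using assms by (metis eq_vecI index_zero_vec)
  then show ?thesis unfolding scalar_prod_def
    by (intro sum_pos2[of _ i]) (auto simp: zero_less_mult_iff)
qed

lemma pos_def_gram:
  assumes B: "B \<in> carrier_mat m n"
    and ker: "\<And>x. x \<in> carrier_vec n \<Longrightarrow> B *\<^sub>v x = 0\<^sub>v m \<Longrightarrow> x = 0\<^sub>v n"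
  shows "pos_def_mat (transpose_mat B * B)"
  unfolding pos_def_mat_def
proof (intro conjI ballI impI)
  show "square_mat (transpose_mat B * B)" by simp
  show "transpose_mat (transpose_mat B * B) = transpose_mat B * B"
    using B by (simp add: transpose_mult[of _ n m _ n])
  fix x :: "real vec"
  assume "x \<in> carrier_vec (dim_row (transpose_mat B * B))" "x \<noteq> 0\<^sub>v (dim_row (transpose_mat B * B))"
  then have x: "x \<in> carrier_vec n" "x \<noteq> 0\<^sub>v n" using B by auto
  have Bx: "B *\<^sub>v x \<in> carrier_vec m" using B x by simp
  have "0 < (B *\<^sub>v x) \<bullet> (B *\<^sub>v x)"
    using scalar_prod_self_pos[of "B *\<^sub>v x"] ker[OF x(1)] x(2) carrier_vecD[OF Bx] by metis
  also have "\<dots> = (transpose_mat B *\<^sub>v (B *\<^sub>v x)) \<bullet> x"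
    using transpose_vec_mult_scalar[OF B x(1) Bx] by simp
  also have "\<dots> = x \<bullet> ((transpose_mat B * B) *\<^sub>v x)"
    using B x Bx by (simp add: comm_scalar_prod[of _ n] assoc_mult_mat_vec[of _ n m _ n])
  finally show "0 < x \<bullet> ((transpose_mat B * B) *\<^sub>v x)" .
qed

lemma diag_of_vec_mult:
  assumes "A \<in> carrier_mat m n" "d \<in> carrier_vec m"
  shows "diag_of_vec d * A = mat m n (\<lambda>(i,j). d $ i * A $$ (i,j))"
  using assms by (simp add: diag_of_vec_def mat_diag_mult_left)

lemma diag_of_vec_mult_vec:
  assumes "A \<in> carrier_mat m n" "d \<in> carrier_vec m" "x \<in> carrier_vec n" "i < m"
  shows "((diag_of_vec d * A) *\<^sub>v x) $ i = d $ i * (A *\<^sub>v x) $ i"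
  using assms unfolding diag_of_vec_mult[OF assms(1,2)]
  by (simp add: scalar_prod_def sum_distrib_left mult.assoc)

lemma pos_def_gram_diag:
  assumes A: "A \<in> carrier_mat m n" and rank: "full_column_rank A"
    and d: "d \<in> carrier_vec m" "positive_vec d"
  shows "pos_def_mat (transpose_mat (diag_of_vec d * A) * (diag_of_vec d * A))"
proof (rule pos_def_gram)
  show "diag_of_vec d * A \<in> carrier_mat m n" using diag_of_vec_mult[OF A d(1)] by simp
  fix x assume x: "x \<in> carrier_vec n" and 0: "diag_of_vec d * A *\<^sub>v x = 0\<^sub>v m"
  have "A *\<^sub>v x = 0\<^sub>v m"
  proof (rule eq_vecI)
    fix i assume "i < dim_vec (0\<^sub>v m :: real vec)"
    then have i: "i < m" by simp
    then have "d $ i * (A *\<^sub>v x) $ i = 0" using diag_of_vec_mult_vec[OF A d(1) x i] 0 by simp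
    moreover have "d $ i > 0" using d i by (auto simp: positive_vec_def)
    ultimately show "(A *\<^sub>v x) $ i = 0\<^sub>v m $ i" using i by simp
  qed (use A in auto)
  then show "x = 0\<^sub>v n" by (rule full_column_rank_kernel[OF A rank x])
qed

text \<open>Let \<open>b\<close> be row \<open>i\<close> and \<open>x\<close> the solution of
  \<open>(B^T B) x = b\<close>. The score is entry \<open>i\<close> of \<open>B x\<close>, and it is
  also the squared norm of \<open>B x\<close>; so its square is at most itself.\<close>

lemma leverage_score_le_1:
  assumes B: "B \<in> carrier_mat m n" and pd: "pos_def_mat (transpose_mat B * B)" and i: "i < m"
  shows "leverage_score B i \<le> 1"
proof -
  let ?G = "transpose_mat B * B"
  have G: "?G \<in> carrier_mat n n" using B by simp
  obtain R where R: "mat_inverse ?G = Some R" "R \<in> carrier_mat n n" "?G * R = 1\<^sub>m n"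
    using pos_def_mat_invertible[OF G pd] by metis
  define b where "b = row B i"
  have b: "b \<in> carrier_vec n" using B by (auto simp: b_def)
  define x where "x = R *\<^sub>v b"
  have x: "x \<in> carrier_vec n" using R b by (simp add: x_def)
  have Gx: "?G *\<^sub>v x = b"
    unfolding x_def using assoc_mult_mat_vec[OF G R(2) b] R(3) b by simp
  have lev: "leverage_score B i = b \<bullet> x"
    using R by (simp add: leverage_score_def b_def x_def)
  have Bx: "B *\<^sub>v x \<in> carrier_vec m" using B x by simp
  have "(b \<bullet> x)\<^sup>2 = ((B *\<^sub>v x) $ i)\<^sup>2" using B i by (simp add: b_def)
  also have "\<dots> \<le> (\<Sum>j<m. ((B *\<^sub>v x) $ j)\<^sup>2)" using i by (intro member_le_sum) auto
  also have "\<dots> = (B *\<^sub>v x) \<bullet> (B *\<^sub>v x)"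
    using Bx B by (simp add: scalar_prod_def power2_eq_square lessThan_atLeast0)
  also have "\<dots> = (transpose_mat B *\<^sub>v (B *\<^sub>v x)) \<bullet> x"
    using transpose_vec_mult_scalar[OF B x Bx] by simp
  also have "transpose_mat B *\<^sub>v (B *\<^sub>v x) = b"
    using Gx B x by (simp add: assoc_mult_mat_vec[of _ n m _ n])
  finally have "(b \<bullet> x)\<^sup>2 \<le> b \<bullet> x" .
  then show ?thesis unfolding lev
    by (cases "0 < b \<bullet> x") (auto simp: power2_eq_square)
qed

text \<open>If \<open>P^T G P = diag(l)\<close> for the Gram matrix \<open>G\<close>, then
  \<open>G^-1 = P diag(1/l) P^T\<close>. The score is therefore the form \<open>diag(1/l)\<close>
  evaluated at \<open>P^T b\<close> for the row \<open>b\<close>.\<close>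

lemma leverage_score_diagonalized:
  assumes B: "B \<in> carrier_mat m n" and pd: "pos_def_mat (transpose_mat B * B)" and i: "i < m"
    and P: "P \<in> carrier_mat n n"
    and diag: "transpose_mat P * (transpose_mat B * B) * P = mat_diag n l"
    and l: "\<And>k. k < n \<Longrightarrow> 0 < l k"
  shows "leverage_score B i = (\<Sum>k<n. ((B * P) $$ (i,k))\<^sup>2 / l k)"
proof -
  let ?G = "transpose_mat B * B"
  let ?D = "mat_diag n (\<lambda>k. 1 / l k)"
  have G: "?G \<in> carrier_mat n n" using B by simp
  have D: "?D \<in> carrier_mat n n" by simp
  have tP: "transpose_mat P \<in> carrier_mat n n" using P by simp
  obtain R where R: "mat_inverse ?G = Some R" "R \<in> carrier_mat n n" "?G * R = 1\<^sub>m n"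
    using pos_def_mat_invertible[OF G pd] by metis
  \<comment> \<open>\<open>L\<close> is a left inverse of the square matrix \<open>P\<close>, hence
    also a right inverse; \<open>P L = 1\<close> is what makes \<open>K\<close> below an inverse of
    the Gram matrix.\<close>
  define L where "L = ?D * (transpose_mat P * ?G)"
  have L: "L \<in> carrier_mat n n" unfolding L_def by (rule mult_carrier_mat[OF D mult_carrier_mat[OF tP G]])
  have "L * P = ?D * (transpose_mat P * ?G * P)"
    unfolding L_def by (rule assoc_mult_mat[OF D mult_carrier_mat[OF tP G] P])
  also have "\<dots> = mat_diag n (\<lambda>k. 1 / l k * l k)" unfolding diag by simp
  also have "\<dots> = 1\<^sub>m n"
  proof -
    have "l k \<noteq> 0" if "k < n" for k using l[OF that] by simp
    then show ?thesis by (intro eq_matI) (auto simp: mat_diag_def)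
  qed
  finally have PL: "P * L = 1\<^sub>m n" using mat_mult_left_right_inverse[OF L P] by blast
  define K where "K = P * (?D * transpose_mat P)"
  have K: "K \<in> carrier_mat n n" unfolding K_def by (rule mult_carrier_mat[OF P mult_carrier_mat[OF D tP]])
  have "K * ?G = P * ((?D * transpose_mat P) * ?G)"
    unfolding K_def by (rule assoc_mult_mat[OF P mult_carrier_mat[OF D tP] G])
  also have "(?D * transpose_mat P) * ?G = L"
    unfolding L_def by (rule assoc_mult_mat[OF D tP G])
  finally have KG: "K * ?G = 1\<^sub>m n" using PL by simp
  have "R = (K * ?G) * R" using R KG by simp
  also have "\<dots> = K * (?G * R)" by (rule assoc_mult_mat[OF K G R(2)])
  also have "\<dots> = K" using R K by simp
  finally have RK: "R = K" .
  define b where "b = row B i"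
  have b: "b \<in> carrier_vec n" using B by (auto simp: b_def)
  define z where "z = transpose_mat P *\<^sub>v b"
  have z: "z \<in> carrier_vec n" using tP b by (simp add: z_def)
  have Dz: "?D *\<^sub>v z = vec n (\<lambda>k. z $ k / l k)"
  proof (rule eq_vecI)
    fix k assume "k < dim_vec (vec n (\<lambda>k. z $ k / l k))"
    then have k: "k < n" by simp
    have "(?D *\<^sub>v z) $ k = (\<Sum>j<n. (if k = j then 1 / l j else 0) * z $ j)"
      using k z by (simp add: mat_diag_def scalar_prod_def lessThan_atLeast0)
    also have "\<dots> = (\<Sum>j<n. if k = j then z $ j / l j else 0)" by (intro sum.cong) auto
    finally show "(?D *\<^sub>v z) $ k = vec n (\<lambda>k. z $ k / l k) $ k" using k by simp
  qed (simp add: mat_diag_def)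
  have zk: "z $ k = (B * P) $$ (i,k)" if "k < n" for k
    using that B P i b by (simp add: z_def b_def comm_scalar_prod[of _ n])
  have "leverage_score B i = b \<bullet> (K *\<^sub>v b)"
    using R RK by (simp add: leverage_score_def b_def)
  also have "K *\<^sub>v b = P *\<^sub>v (?D *\<^sub>v z)"
    unfolding K_def z_def assoc_mult_mat_vec[OF P mult_carrier_mat[OF D tP] b]
      assoc_mult_mat_vec[OF D tP b] ..
  also have "b \<bullet> \<dots> = z \<bullet> (?D *\<^sub>v z)"
    using transpose_vec_mult_scalar[OF P mult_mat_vec_carrier[OF D z] b] by (simp add: z_def)
  also have "\<dots> = (\<Sum>k<n. (z $ k)\<^sup>2 / l k)"
    unfolding Dz using z by (simp add: scalar_prod_def lessThan_atLeast0 power2_eq_square)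
  finally show ?thesis using zk by simp
qed

text \<open>This turns the linear algebra into scalar sums, all that the entropy argument uses.
  \<open>y\<close> holds the entries of \<open>A P\<close>, where \<open>P\<close> takes the Gram
  matrix of the \<open>e\<close>-scaled \<open>A\<close> to the identity and that of the
  \<open>d\<close>-scaled \<open>A\<close> to \<open>diag(l)\<close>. The weighted column sums are
  the diagonal entries of these two forms.\<close>

lemma leverage_scores_simultaneous:
  assumes A: "A \<in> carrier_mat m n" and rank: "full_column_rank A"
    and d: "d \<in> carrier_vec m" "positive_vec d" and e: "e \<in> carrier_vec m" "positive_vec e"
  obtains y :: "nat \<Rightarrow> nat \<Rightarrow> real" and l :: "nat \<Rightarrow> real" where
    "\<And>k. k < n \<Longrightarrow> 0 < l k"
    "\<And>k. k < n \<Longrightarrow> (\<Sum>i<m. (e $ i)\<^sup>2 * (y i k)\<^sup>2) = 1"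
    "\<And>k. k < n \<Longrightarrow> (\<Sum>i<m. (d $ i)\<^sup>2 * (y i k)\<^sup>2) = l k"
    "\<And>i. i < m \<Longrightarrow> leverage_score (diag_of_vec e * A) i = (e $ i)\<^sup>2 * (\<Sum>k<n. (y i k)\<^sup>2)"
    "\<And>i. i < m \<Longrightarrow> leverage_score (diag_of_vec d * A) i = (d $ i)\<^sup>2 * (\<Sum>k<n. (y i k)\<^sup>2 / l k)"
proof -
  let ?D = "diag_of_vec d * A" and ?E = "diag_of_vec e * A"
  have D: "?D \<in> carrier_mat m n" and E: "?E \<in> carrier_mat m n"
    using diag_of_vec_mult[OF A d(1)] diag_of_vec_mult[OF A e(1)] by auto
  note pdD = pos_def_gram_diag[OF A rank d] and pdE = pos_def_gram_diag[OF A rank e]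
  have "transpose_mat (transpose_mat ?D * ?D) = transpose_mat ?D * ?D"
    using pdD unfolding pos_def_mat_def by blast
  then obtain P l where P: "P \<in> carrier_mat n n"
    and PE: "transpose_mat P * (transpose_mat ?E * ?E) * P = 1\<^sub>m n"
    and PD: "transpose_mat P * (transpose_mat ?D * ?D) * P = mat_diag n l"
    using simultaneous_diagonalization[of "transpose_mat ?E * ?E" n "transpose_mat ?D * ?D"] pdE D E
    by auto
  define y where "y i k = (A * P) $$ (i,k)" for i k
  have ent: "((diag_of_vec c * A) * P) $$ (i,k) = c $ i * y i k"
    if "c \<in> carrier_vec m" "i < m" "k < n" for c i k
    using that A P unfolding diag_of_vec_mult[OF A that(1)] y_def
    by (simp add: scalar_prod_def sum_distrib_left mult.assoc)
  have diag: "(transpose_mat P * (transpose_mat (diag_of_vec c * A) * (diag_of_vec c * A)) * P) $$ (k,k)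
      = (\<Sum>i<m. (c $ i)\<^sup>2 * (y i k)\<^sup>2)" if c: "c \<in> carrier_vec m" and k: "k < n" for c k
  proof -
    let ?C = "diag_of_vec c * A"
    have C: "?C \<in> carrier_mat m n" using diag_of_vec_mult[OF A c] by auto
    define X where "X = ?C * P"
    have X: "X \<in> carrier_mat m n" using C P by (simp add: X_def)
    have "transpose_mat P * (transpose_mat ?C * ?C) * P = transpose_mat X * X"
      unfolding X_def using C P by (simp add: transpose_mult[of _ m n _ n] assoc_mult_mat[of _ n n _ n _ n]
          assoc_mult_mat[of _ n n _ m _ n] assoc_mult_mat[of _ n m _ n _ n])
    then have "(transpose_mat P * (transpose_mat ?C * ?C) * P) $$ (k,k) = col X k \<bullet> col X k"
      using X k by simp
    also have "\<dots> = (\<Sum>i<m. (X $$ (i,k))\<^sup>2)"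
      using X k by (simp add: scalar_prod_def lessThan_atLeast0 power2_eq_square)
    finally show ?thesis using ent[OF c] k by (simp add: X_def power_mult_distrib)
  qed
  have s1: "(\<Sum>i<m. (e $ i)\<^sup>2 * (y i k)\<^sup>2) = 1" if "k < n" for k
    using diag[OF e(1) that] that unfolding PE by simp
  have s2: "(\<Sum>i<m. (d $ i)\<^sup>2 * (y i k)\<^sup>2) = l k" if "k < n" for k
    using diag[OF d(1) that] that unfolding PD by (simp add: mat_diag_def)
  \<comment> \<open>The normalization \<open>s1\<close> shows that column \<open>k\<close> of
    \<open>y\<close> is not zero, and the scales \<open>d\<close> are positive.\<close>
  have l: "0 < l k" if k: "k < n" for k
  proof -
    obtain i where i: "i < m" "y i k \<noteq> 0"
      using s1[OF k] by (metis (no_types, lifting) lessThan_iff mult_zero_right sum.neutral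
          zero_neq_one zero_power2)
    then have "0 < (d $ i)\<^sup>2 * (y i k)\<^sup>2" using d by (auto simp: positive_vec_def)
    then have "0 < (\<Sum>i<m. (d $ i)\<^sup>2 * (y i k)\<^sup>2)" using i by (intro sum_pos2[of _ i]) auto
    then show ?thesis using s2[OF k] by simp
  qed
  have PE': "transpose_mat P * (transpose_mat ?E * ?E) * P = mat_diag n (\<lambda>_. 1)"
    using PE by simp
  show thesis
  proof (rule that[of l y])
    fix i assume i: "i < m"
    have "leverage_score ?E i = (\<Sum>k<n. ((?E * P) $$ (i,k))\<^sup>2 / 1)"
      by (rule leverage_score_diagonalized[OF E pdE i P PE']) simp
    also have "\<dots> = (\<Sum>k<n. (e $ i * y i k)\<^sup>2 / 1)"
      by (rule sum.cong) (simp_all only: lessThan_iff ent[OF e(1) i])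
    finally show "leverage_score ?E i = (e $ i)\<^sup>2 * (\<Sum>k<n. (y i k)\<^sup>2)"
      by (simp add: power_mult_distrib sum_distrib_left)
    have "leverage_score ?D i = (\<Sum>k<n. ((?D * P) $$ (i,k))\<^sup>2 / l k)"
      by (rule leverage_score_diagonalized[OF D pdD i P PD]) (rule l)
    also have "\<dots> = (\<Sum>k<n. (d $ i * y i k)\<^sup>2 / l k)"
      by (rule sum.cong) (simp_all only: lessThan_iff ent[OF d(1) i])
    finally show "leverage_score ?D i = (d $ i)\<^sup>2 * (\<Sum>k<n. (y i k)\<^sup>2 / l k)"
      by (simp add: power_mult_distrib sum_distrib_left)
  qed (rule l s1 s2, assumption)+
qed

section \<open>Contraction of the relative entropy\<close>

text \<open>Relative entropy without normalization: the vectors compared below have total mass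
  \<open>n\<close>, not 1.\<close>

definition kl :: "nat \<Rightarrow> (nat \<Rightarrow> real) \<Rightarrow> (nat \<Rightarrow> real) \<Rightarrow> real" where
  "kl m a b = (\<Sum>i<m. a i * ln (a i / b i))"

text \<open>Gibbs' inequality: \<open>ln x \<le> x - 1\<close> bounds each term below by
  \<open>a i - b i\<close>.\<close>

lemma kl_nonneg:
  assumes pos: "\<And>i. i < m \<Longrightarrow> 0 < a i \<and> 0 < b i" and "sum b {..<m} \<le> sum a {..<m}"
  shows "0 \<le> kl m a b"
proof -
  have "a i - b i \<le> a i * ln (a i / b i)" if "i < m" for i
  proof -
    have "ln (b i / a i) \<le> b i / a i - 1" using pos[OF that] by (intro ln_le_minus_one) auto
    then have "1 - b i / a i \<le> ln (a i / b i)" using pos[OF that] by (simp add: ln_div)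
    then have "a i * (1 - b i / a i) \<le> a i * ln (a i / b i)"
      using pos[OF that] by (intro mult_left_mono) auto
    then show ?thesis using pos[OF that] by (simp add: algebra_simps)
  qed
  then have "(\<Sum>i<m. a i - b i) \<le> kl m a b" unfolding kl_def by (intro sum_mono) auto
  then show ?thesis using assms(2) by (simp add: sum_subtractf)
qed

text \<open>Jensen's inequality for \<open>ln\<close>, by averaging the tangent bound
  \<open>ln x \<le> x / t + ln t - 1\<close> at the mean \<open>t\<close>.\<close>

lemma sum_ln_le_ln_sum:
  fixes q x :: "'a \<Rightarrow> real"
  assumes "finite I" and q: "\<And>k. k \<in> I \<Longrightarrow> 0 \<le> q k" and "sum q I = 1"
    and x: "\<And>k. k \<in> I \<Longrightarrow> 0 < x k"
  shows "(\<Sum>k\<in>I. q k * ln (x k)) \<le> ln (\<Sum>k\<in>I. q k * x k)"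
proof -
  define t where "t = (\<Sum>k\<in>I. q k * x k)"
  obtain j where j: "j \<in> I" "q j \<noteq> 0" using assms(3) sum.neutral[of I q] by (metis zero_neq_one)
  have "0 < q j" using q[OF j(1)] j(2) by simp
  then have "0 < t" unfolding t_def
    using j x[OF j(1)] assms(1) q x by (intro sum_pos2[of _ j]) (auto simp: less_imp_le)
  have "q k * ln (x k) \<le> q k * x k / t + q k * (ln t - 1)" if "k \<in> I" for k
  proof -
    have "ln (x k / t) \<le> x k / t - 1" using x[OF that] \<open>0 < t\<close> by (intro ln_le_minus_one) auto
    then have "ln (x k) \<le> x k / t + (ln t - 1)" using x[OF that] \<open>0 < t\<close> by (simp add: ln_div)
    then have "q k * ln (x k) \<le> q k * (x k / t + (ln t - 1))" using q[OF that] by (rule mult_left_mono)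
    then show ?thesis by (simp add: distrib_left)
  qed
  then have "(\<Sum>k\<in>I. q k * ln (x k)) \<le> (\<Sum>k\<in>I. q k * x k / t + q k * (ln t - 1))" by (rule sum_mono)
  also have "\<dots> = t / t + sum q I * (ln t - 1)"
    unfolding sum.distrib sum_distrib_right[symmetric] sum_divide_distrib[symmetric] t_def[symmetric] ..
  also have "\<dots> = ln t" using \<open>0 < t\<close> assms(3) by simp
  finally show ?thesis by (simp add: t_def)
qed

text \<open>Weighted AM-GM: the two-point case of \<open>sum_ln_le_ln_sum\<close>,
  exponentiated.\<close>

lemma powr_mult_powr_le:
  fixes x y a :: real
  assumes "0 < x" "0 < y" "0 \<le> a" "a \<le> 1"
  shows "x powr a * y powr (1 - a) \<le> a * x + (1 - a) * y"
proof -
  have pos: "0 < a * x + (1 - a) * y"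
    using assms by (cases "a = 0") (auto intro: add_pos_nonneg)
  have "a * ln x + (1 - a) * ln y \<le> ln (a * x + (1 - a) * y)"
    using sum_ln_le_ln_sum[of "{True, False}" "\<lambda>b. if b then a else 1 - a" "\<lambda>b. if b then x else y"] assms
    by auto
  then have "exp (a * ln x + (1 - a) * ln y) \<le> a * x + (1 - a) * y"
    using pos by (metis exp_le_cancel_iff exp_ln)
  then show ?thesis using assms by (simp add: powr_def exp_add mult.commute)
qed

text \<open>With \<open>x = exp s\<close>, squaring \<open>1 + s/2 \<le> exp (s/2)\<close> gives
  \<open>exp s - 1 - s \<ge> s^2 / 4\<close>, which the hypothesis bounds by
  \<open>d^2\<close>.\<close>

lemma abs_ln_le:
  fixes x d :: real
  assumes "0 < x" "x - 1 - ln x \<le> d\<^sup>2" "0 \<le> d" "d \<le> 1"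
  shows "\<bar>ln x\<bar> \<le> 2 * d"
proof -
  define s where "s = ln x"
  have x: "x = exp s" using assms by (simp add: s_def)
  \<comment> \<open>Squaring needs \<open>1 + s/2 \<ge> 0\<close>. If \<open>s < -2\<close>, then
    \<open>x - 1 - s > 1\<close>, against \<open>d^2 \<le> 1\<close>.\<close>
  have s2: "-2 \<le> s"
  proof (rule ccontr)
    assume "\<not> ?thesis"
    moreover have "d\<^sup>2 \<le> 1" using assms by (simp add: power_le_one)
    ultimately show False using assms(1,2) unfolding s_def by linarith
  qed
  have "(1 + s / 2)\<^sup>2 \<le> (exp (s / 2))\<^sup>2"
    using s2 exp_ge_add_one_self[of "s / 2"] by (intro power_mono) auto
  also have "\<dots> = x" unfolding x by (simp add: power2_eq_square flip: exp_add)
  finally have "s\<^sup>2 \<le> (2 * d)\<^sup>2"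
    using assms(2) unfolding s_def by (simp add: power2_eq_square algebra_simps)
  then show ?thesis using assms(3) unfolding s_def by (metis abs_le_square_iff abs_of_nonneg mult_nonneg_nonneg zero_le_numeral)
qed

text \<open>
  In a basis in which \<open>M(wbar)\<close> is the identity and \<open>M(w)\<close> is \<open>diag(l)\<close>, the entry \<open>c i k\<close> is the
  squared \<open>k\<close>-th coordinate of row \<open>i\<close> of \<open>A\<close>, and \<open>gap\<close> below is
  \<open>log det M(wbar) - log det M(w)\<close>.
\<close>

locale lewis_step =
  fixes m n :: nat and a :: real and wbar w w' :: "nat \<Rightarrow> real"
    and c :: "nat \<Rightarrow> nat \<Rightarrow> real" and l :: "nat \<Rightarrow> real"
  assumes a: "0 < a" "a < 1"
    and pos: "\<And>i. i < m \<Longrightarrow> 0 < wbar i" "\<And>i. i < m \<Longrightarrow> 0 < w i"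
    and c: "\<And>i k. 0 \<le> c i k" and l: "\<And>k. k < n \<Longrightarrow> 0 < l k"
    and isotropic: "\<And>k. k < n \<Longrightarrow> (\<Sum>i<m. wbar i powr a * c i k) = 1"
    and spectrum: "\<And>k. k < n \<Longrightarrow> (\<Sum>i<m. w i powr a * c i k) = l k"
    and fixpoint: "\<And>i. i < m \<Longrightarrow> wbar i = wbar i powr a * (\<Sum>k<n. c i k)"
    and step: "\<And>i. i < m \<Longrightarrow> w' i = w i powr a * (\<Sum>k<n. c i k / l k)"
    and sum_w: "(\<Sum>i<m. w i) = real n"
begin

text \<open>\<open>taubar i\<close> and \<open>tau i\<close> are the inverse quadratic forms of
  \<open>M(wbar)\<close> and \<open>M(w)\<close> at row \<open>i\<close> of \<open>A\<close>, that
  is, leverage scores with the row weight divided out.\<close>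

definition "taubar i = (\<Sum>k<n. c i k)"
definition "tau i = (\<Sum>k<n. c i k / l k)"
definition "gap = - (\<Sum>k<n. ln (l k))"

text \<open>The fixed-point equation divided by \<open>wbar i powr a\<close>. For
  \<open>a = 1 - 2/p\<close> the exponent is \<open>2/p\<close>, whence the final power
  \<open>p/2\<close> of the algorithm.\<close>

lemma taubar_powr: "i < m \<Longrightarrow> taubar i = wbar i powr (1 - a)"
  using fixpoint[of i] pos(1)[of i] by (simp add: taubar_def powr_diff field_simps)

lemma taubar_pos: "i < m \<Longrightarrow> 0 < taubar i"
  using taubar_powr pos(1)[of i] by simp

lemma tau_pos:
  assumes "i < m"
  shows "0 < tau i"
proof -
  obtain k where "k < n" "c i k \<noteq> 0"
    using taubar_pos[OF assms] unfolding taubar_def by (metis lessThan_iff less_irrefl sum.neutral)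
  then show ?thesis unfolding tau_def using c l
    by (intro sum_pos2[of _ k]) (auto simp: order_less_le less_imp_le intro!: divide_nonneg_pos)
qed

lemma w'_pos: "i < m \<Longrightarrow> 0 < w' i"
  using step[of i] tau_pos[of i] pos(2)[of i] by (simp add: tau_def)

text \<open>The trace identity for leverage scores: after exchanging the sums, each of the
  \<open>n\<close> coordinates contributes 1. The same computation gives \<open>sum_w'\<close>, with
  contributions \<open>l k / l k\<close>.\<close>

lemma sum_wbar: "(\<Sum>i<m. wbar i) = real n"
proof -
  have "(\<Sum>i<m. wbar i) = (\<Sum>i<m. \<Sum>k<n. wbar i powr a * c i k)"
    using fixpoint by (intro sum.cong) (auto simp: sum_distrib_left[symmetric])
  also have "\<dots> = (\<Sum>k<n. \<Sum>i<m. wbar i powr a * c i k)" by (rule sum.swap)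
  finally show ?thesis using isotropic by simp
qed

lemma sum_w': "(\<Sum>i<m. w' i) = real n"
proof -
  have "(\<Sum>i<m. w' i) = (\<Sum>i<m. \<Sum>k<n. w i powr a * c i k / l k)"
    using step by (intro sum.cong) (auto simp: sum_distrib_left)
  also have "\<dots> = (\<Sum>k<n. \<Sum>i<m. w i powr a * c i k / l k)" by (rule sum.swap)
  also have "\<dots> = (\<Sum>k<n. 1)"
    using spectrum l by (intro sum.cong) (auto simp: sum_divide_distrib[symmetric] less_imp_neq[symmetric])
  finally show ?thesis by simp
qed

text \<open>The sum is the trace of \<open>M(w)\<close> in the chosen basis, which equals the sum of
  \<open>w i powr a * wbar i powr (1 - a)\<close>. AM-GM bounds it by
  \<open>a n + (1 - a) n\<close>.\<close>

lemma sum_l_le: "(\<Sum>k<n. l k) \<le> real n"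
proof -
  have "(\<Sum>k<n. l k) = (\<Sum>k<n. \<Sum>i<m. w i powr a * c i k)" using spectrum by simp
  also have "\<dots> = (\<Sum>i<m. w i powr a * taubar i)"
    unfolding taubar_def sum_distrib_left by (rule sum.swap)
  also have "\<dots> \<le> (\<Sum>i<m. a * w i + (1 - a) * wbar i)"
    using taubar_powr pos a powr_mult_powr_le by (intro sum_mono) (auto simp: less_imp_le)
  also have "\<dots> = real n"
    unfolding sum.distrib sum_distrib_left[symmetric] sum_w sum_wbar by (simp add: algebra_simps)
  finally show ?thesis .
qed

text \<open>For fixed \<open>i\<close> the numbers \<open>c i k / taubar i\<close> are
  probabilities, under which the mean of \<open>1 / l k\<close> is \<open>tau i / taubar i\<close>.
  Jensen bounds \<open>ln (taubar i / tau i)\<close> by the mean of \<open>ln (l k)\<close>. Summed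
  over \<open>i\<close> with weights \<open>wbar i\<close>, each \<open>ln (l k)\<close> gets total
  weight 1 by \<open>isotropic\<close>.\<close>

lemma kl_contraction: "kl m wbar w' \<le> a * kl m wbar w - gap"
proof -
  have "wbar i * ln (wbar i / w' i) \<le> a * (wbar i * ln (wbar i / w i)) + (\<Sum>k<n. ln (l k) * (wbar i powr a * c i k))"
    if i: "i < m" for i
  proof -
    have "(\<Sum>k<n. c i k / taubar i * ln (1 / l k)) \<le> ln (\<Sum>k<n. c i k / taubar i * (1 / l k))"
      using c l taubar_pos[OF i]
      by (intro sum_ln_le_ln_sum) (auto simp: sum_divide_distrib[symmetric] taubar_def less_imp_le)
    also have "(\<Sum>k<n. c i k / taubar i * (1 / l k)) = tau i / taubar i"
      unfolding tau_def by (simp add: sum_divide_distrib mult.commute)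
    also have "(\<Sum>k<n. c i k / taubar i * ln (1 / l k)) = - (\<Sum>k<n. c i k / taubar i * ln (l k))"
      unfolding sum_negf[symmetric] using l by (intro sum.cong) (auto simp: ln_div dest: less_imp_neq)
    finally have "wbar i * (ln (taubar i) - ln (tau i)) \<le> wbar i * (\<Sum>k<n. c i k / taubar i * ln (l k))"
      using tau_pos[OF i] taubar_pos[OF i] pos(1)[OF i]
      by (intro mult_left_mono) (auto simp: ln_div)
    also have "\<dots> = (\<Sum>k<n. ln (l k) * (wbar i powr a * c i k))"
    proof -
      have "wbar i / taubar i = wbar i powr a"
        using fixpoint[OF i] taubar_pos[OF i] by (simp add: taubar_def field_simps)
      then show ?thesis
        unfolding sum_distrib_left by (intro sum.cong) (simp_all add: mult_ac flip: \<open>wbar i / taubar i = wbar i powr a\<close>)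
    qed
    finally have *: "wbar i * (ln (taubar i) - ln (tau i)) \<le> \<dots>" .
    have "ln (w' i) = a * ln (w i) + ln (tau i)"
      using step[OF i] tau_pos[OF i] pos(2)[OF i] by (simp add: tau_def ln_mult ln_powr)
    moreover have "ln (taubar i) = (1 - a) * ln (wbar i)"
      using taubar_powr[OF i] pos(1)[OF i] by (simp add: ln_powr)
    \<comment> \<open>Split \<open>ln (wbar i)\<close> into its multiples by \<open>a\<close> and
      \<open>1 - a\<close>; the second one is \<open>ln (taubar i)\<close>.\<close>
    ultimately have ln_ratio: "ln (wbar i / w' i) = a * ln (wbar i / w i) + (ln (taubar i) - ln (tau i))"
      using pos[OF i] w'_pos[OF i] by (simp add: ln_div algebra_simps)
    have "wbar i * ln (wbar i / w' i)
        = a * (wbar i * ln (wbar i / w i)) + wbar i * (ln (taubar i) - ln (tau i))"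
      unfolding ln_ratio by (simp only: distrib_left mult.left_commute)
    then show ?thesis using * by simp
  qed
  then have "kl m wbar w' \<le> (\<Sum>i<m. a * (wbar i * ln (wbar i / w i)) + (\<Sum>k<n. ln (l k) * (wbar i powr a * c i k)))"
    unfolding kl_def by (intro sum_mono) auto
  also have "\<dots> = a * kl m wbar w + (\<Sum>k<n. \<Sum>i<m. ln (l k) * (wbar i powr a * c i k))"
    unfolding kl_def sum.distrib sum_distrib_left by (simp add: sum.swap[of _ "{..<m}" "{..<n}"])
  also have "(\<Sum>k<n. \<Sum>i<m. ln (l k) * (wbar i powr a * c i k)) = - gap"
    unfolding gap_def sum_distrib_left[symmetric] using isotropic by simp
  finally show ?thesis by simp
qed

lemma gap_nonneg: "0 \<le> gap"
proof -
  have "(\<Sum>k<n. ln (l k)) \<le> (\<Sum>k<n. l k - 1)" using l by (intro sum_mono ln_le_minus_one) auto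
  also have "\<dots> \<le> 0" using sum_l_le by (simp add: sum_subtractf)
  finally show ?thesis by (simp add: gap_def)
qed

text \<open>\<open>wbar\<close> and \<open>w'\<close> have equal mass, so the left side of
  \<open>kl_contraction\<close> is nonnegative and the inequality turns into a bound on the
  gap.\<close>

lemma gap_le: "gap \<le> a * kl m wbar w"
  using kl_contraction kl_nonneg[of m wbar w'] pos(1) w'_pos sum_wbar sum_w' by simp

text \<open>The terms \<open>l k - 1 - ln (l k)\<close> are nonnegative and, by
  \<open>sum_l_le\<close>, add up to at most the gap. So each of them is small, and
  \<open>abs_ln_le\<close> applies.\<close>

lemma abs_ln_l_le:
  assumes "a * kl m wbar w \<le> d\<^sup>2" "0 \<le> d" "d \<le> 1" and k: "k < n"
  shows "\<bar>ln (l k)\<bar> \<le> 2 * d"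
proof (rule abs_ln_le)
  have "l k - 1 - ln (l k) \<le> (\<Sum>k<n. l k - 1 - ln (l k))"
    using k ln_le_minus_one[OF l] by (intro member_le_sum) auto
  also have "\<dots> \<le> gap" using sum_l_le by (simp add: sum_subtractf gap_def)
  finally show "l k - 1 - ln (l k) \<le> d\<^sup>2" using gap_le assms(1) by linarith
qed (use assms l in auto)

lemma tau_bounds:
  assumes "a * kl m wbar w \<le> d\<^sup>2" "0 \<le> d" "d \<le> 1" and i: "i < m"
  shows "exp (- 2 * d) * taubar i \<le> tau i" "tau i \<le> exp (2 * d) * taubar i"
proof -
  have "exp (- 2 * d) \<le> 1 / l k \<and> 1 / l k \<le> exp (2 * d)" if k: "k < n" for k
  proof -
    have "1 / l k = exp (- ln (l k))" using l[OF k] by (simp add: exp_minus field_simps)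
    then show ?thesis using abs_ln_l_le[OF assms(1-3) k] by (simp add: abs_le_iff)
  qed
  then have b: "exp (- 2 * d) * c i k \<le> c i k / l k" "c i k / l k \<le> exp (2 * d) * c i k" if "k < n" for k
    using mult_right_mono[of _ _ "c i k"] c that by fastforce+
  show "exp (- 2 * d) * taubar i \<le> tau i" "tau i \<le> exp (2 * d) * taubar i"
    unfolding taubar_def tau_def sum_distrib_left using b by (auto intro!: sum_mono)
qed

end

section \<open>The fixed-point iteration\<close>

text \<open>The bridge from matrices to \<open>lewis_step\<close>. Squaring the row scale
  \<open>w powr (1/2 - 1/p)\<close> gives the weight \<open>w powr (1 - 2/p)\<close>, and
  \<open>c i k\<close> is the square of \<open>y i k\<close>.\<close>

lemma lewis_step_exists:
  assumes A: "A \<in> carrier_mat m n" and rank: "full_column_rank A" and p: "2 < p"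
    and wbar: "is_lewis_weights A p wbar"
    and w: "w \<in> carrier_vec m" "positive_vec w" "(\<Sum>i<m. w $ i) = real n"
  obtains c l where "lewis_step m n (1 - 2 / p) (\<lambda>i. wbar $ i) (\<lambda>i. w $ i)
    (\<lambda>i. leverage_scores (lewis_rescale A p w) $ i) c l"
proof -
  define r where "r v = map_vec (\<lambda>x. x powr (1/2 - 1/p)) v" for v :: "real vec"
  have r: "r v \<in> carrier_vec m" "positive_vec (r v)" "\<And>i. i < m \<Longrightarrow> (r v $ i)\<^sup>2 = v $ i powr (1 - 2 / p)"
    if "v \<in> carrier_vec m" "positive_vec v" for v
  proof -
    show "r v \<in> carrier_vec m" "positive_vec (r v)" using that by (auto simp: r_def positive_vec_def)
    fix i assume "i < m"
    then have "r v $ i = v $ i powr (1/2 - 1/p)" using that by (simp add: r_def)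
    then show "(r v $ i)\<^sup>2 = v $ i powr (1 - 2 / p)"
      by (simp add: power2_eq_square algebra_simps flip: powr_add)
  qed
  have resc: "lewis_rescale A p v = diag_of_vec (r v) * A" for v by (simp add: lewis_rescale_def r_def)
  have wb: "wbar \<in> carrier_vec m" "positive_vec wbar"
    "\<And>i. i < m \<Longrightarrow> wbar $ i = leverage_score (lewis_rescale A p wbar) i"
    using wbar A by (auto simp: is_lewis_weights_def)
  have dim: "dim_row (lewis_rescale A p w) = m"
    using diag_of_vec_mult[OF A r(1)[OF w(1,2)]] by (simp add: resc)
  show thesis
  proof (rule leverage_scores_simultaneous[OF A rank r(1,2)[OF w(1,2)] r(1,2)[OF wb(1,2)]])
    fix y :: "nat \<Rightarrow> nat \<Rightarrow> real" and l :: "nat \<Rightarrow> real"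
    assume yl: "\<And>k. k < n \<Longrightarrow> 0 < l k"
      "\<And>k. k < n \<Longrightarrow> (\<Sum>i<m. (r wbar $ i)\<^sup>2 * (y i k)\<^sup>2) = 1"
      "\<And>k. k < n \<Longrightarrow> (\<Sum>i<m. (r w $ i)\<^sup>2 * (y i k)\<^sup>2) = l k"
      "\<And>i. i < m \<Longrightarrow> leverage_score (diag_of_vec (r wbar) * A) i = (r wbar $ i)\<^sup>2 * (\<Sum>k<n. (y i k)\<^sup>2)"
      "\<And>i. i < m \<Longrightarrow> leverage_score (diag_of_vec (r w) * A) i = (r w $ i)\<^sup>2 * (\<Sum>k<n. (y i k)\<^sup>2 / l k)"
    show thesis
    proof (rule that[of "\<lambda>i k. (y i k)\<^sup>2" l], unfold_locales)
      show "0 < 1 - 2 / p" "1 - 2 / p < 1" using p by auto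
      show "(\<Sum>i<m. w $ i) = real n" by (rule w(3))
      show "(\<Sum>i<m. wbar $ i powr (1 - 2 / p) * (y i k)\<^sup>2) = 1" if "k < n" for k
        using yl(2)[OF that] r(3)[OF wb(1,2)] by simp
      show "(\<Sum>i<m. w $ i powr (1 - 2 / p) * (y i k)\<^sup>2) = l k" if "k < n" for k
        using yl(3)[OF that] r(3)[OF w(1,2)] by simp
      show "wbar $ i = wbar $ i powr (1 - 2 / p) * (\<Sum>k<n. (y i k)\<^sup>2)" if "i < m" for i
        using trans[OF wb(3)[OF that] yl(4)[OF that, folded resc]] unfolding r(3)[OF wb(1,2) that] .
      show "leverage_scores (lewis_rescale A p w) $ i
          = w $ i powr (1 - 2 / p) * (\<Sum>k<n. (y i k)\<^sup>2 / l k)" if "i < m" for i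
        using yl(5)[OF that] r(3)[OF w(1,2) that] that dim by (simp add: leverage_scores_def resc)
    qed (use wb(1,2) w(1,2) yl(1) in \<open>auto simp: positive_vec_def\<close>)
  qed
qed

lemma lewis_weights_le_1:
  assumes A: "A \<in> carrier_mat m n" and rank: "full_column_rank A"
    and wbar: "is_lewis_weights A p wbar" and i: "i < m"
  shows "wbar $ i \<le> 1"
proof -
  define d where "d = map_vec (\<lambda>x. x powr (1/2 - 1/p)) wbar"
  have d: "d \<in> carrier_vec m" "positive_vec d"
    using wbar A by (auto simp: is_lewis_weights_def d_def positive_vec_def)
  have "diag_of_vec d * A \<in> carrier_mat m n" using diag_of_vec_mult[OF A d(1)] by simp
  then have "leverage_score (diag_of_vec d * A) i \<le> 1"
    using leverage_score_le_1 pos_def_gram_diag[OF A rank d] i by blast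
  then show ?thesis using wbar A i by (simp add: is_lewis_weights_def lewis_rescale_def d_def)
qed

section \<open>Recursion, invariants and log of the run\<close>

lemma fst_lewis_run_Suc:
  "fst (lewis_run A p (Suc t)) = leverage_scores (lewis_rescale A p (fst (lewis_run A p t)))"
  by (simp add: case_prod_beta Let_def)

lemma snd_lewis_run_Suc:
  "snd (lewis_run A p (Suc t)) = snd (lewis_run A p t) @
     [(lewis_rescale A p (fst (lewis_run A p t)), leverage_scores (lewis_rescale A p (fst (lewis_run A p t))))]"
  by (simp add: case_prod_beta Let_def)

declare lewis_run.simps(2) [simp del]

lemma length_lewis_run: "length (snd (lewis_run A p t)) = t"
  by (induction t) (simp_all add: snd_lewis_run_Suc)

text \<open>The invariant includes the mass because \<open>lewis_step\<close> assumes mass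
  \<open>n\<close>. It holds for \<open>m\<close> copies of \<open>n/m\<close> and persists by the
  trace identity.\<close>

lemma lewis_run_iterate:
  assumes A: "A \<in> carrier_mat m n" and rank: "full_column_rank A" and p: "2 < p"
    and wbar: "is_lewis_weights A p wbar" and "0 < n" "0 < m"
  shows "fst (lewis_run A p t) \<in> carrier_vec m \<and> positive_vec (fst (lewis_run A p t)) \<and>
    (\<Sum>i<m. fst (lewis_run A p t) $ i) = real n"
proof (induction t)
  case 0
  then show ?case using assms by (auto simp: positive_vec_def)
next
  case (Suc t)
  let ?w = "fst (lewis_run A p t)"
  obtain c l where step: "lewis_step m n (1 - 2 / p) (\<lambda>i. wbar $ i) (\<lambda>i. ?w $ i)
      (\<lambda>i. leverage_scores (lewis_rescale A p ?w) $ i) c l"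
    using lewis_step_exists[OF A rank p wbar] Suc by blast
  have "leverage_scores (lewis_rescale A p ?w) \<in> carrier_vec m"
    using Suc by (simp add: leverage_scores_def lewis_rescale_def diag_of_vec_def mat_diag_def)
  then show ?case unfolding fst_lewis_run_Suc
    using lewis_step.w'_pos[OF step] lewis_step.sum_w'[OF step] by (auto simp: positive_vec_def)
qed

lemma lewis_run_log:
  assumes A: "A \<in> carrier_mat m n" and rank: "full_column_rank A" and p: "2 < p"
    and wbar: "is_lewis_weights A p wbar" and "0 < n" "0 < m"
    and "(B, s) \<in> set (snd (lewis_run A p t))"
  shows "\<exists>d \<in> carrier_vec m. positive_vec d \<and> B = diag_of_vec d * A \<and> s = leverage_scores B"
  using assms(7)
proof (induction t)
  case 0
  then show ?case by simp
next
  case (Suc t)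
  let ?w = "fst (lewis_run A p t)"
  have "map_vec (\<lambda>x. x powr (1/2 - 1/p)) ?w \<in> carrier_vec m"
    "positive_vec (map_vec (\<lambda>x. x powr (1/2 - 1/p)) ?w)"
    using lewis_run_iterate[OF assms(1-6), of t] by (auto simp: positive_vec_def)
  then have "\<exists>d \<in> carrier_vec m. positive_vec d \<and> lewis_rescale A p ?w = diag_of_vec d * A"
    unfolding lewis_rescale_def by blast
  moreover have "(B, s) \<in> set (snd (lewis_run A p t)) \<or>
      B = lewis_rescale A p ?w \<and> s = leverage_scores B"
    using Suc.prems unfolding snd_lewis_run_Suc by auto
  ultimately show ?case using Suc.IH by metis
qed

text \<open>At the start \<open>wbar i \<le> 1\<close> makes every ratio, hence its logarithm, at
  most \<open>m/n\<close>, and the weights \<open>wbar i\<close> sum to \<open>n\<close>; so the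
  divergence is at most \<open>m\<close>. Each iteration then contracts it, the gap being
  nonnegative.\<close>

lemma kl_lewis_run_le:
  assumes A: "A \<in> carrier_mat m n" and rank: "full_column_rank A" and p: "2 < p"
    and wbar: "is_lewis_weights A p wbar" and "0 < n" "0 < m"
  shows "kl m (\<lambda>i. wbar $ i) (\<lambda>i. fst (lewis_run A p t) $ i) \<le> (1 - 2 / p) ^ t * real m"
proof (induction t)
  case 0
  let ?w = "\<lambda>i. fst (lewis_run A p 0) $ i"
  have w: "?w i = real n / real m" if "i < m" for i using A that by simp
  have pos: "0 < wbar $ i" if "i < m" for i
    using wbar A that by (auto simp: is_lewis_weights_def positive_vec_def)
  obtain c l where step: "lewis_step m n (1 - 2 / p) (\<lambda>i. wbar $ i) ?w
      (\<lambda>i. leverage_scores (lewis_rescale A p (fst (lewis_run A p 0))) $ i) c l"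
    using lewis_step_exists[OF A rank p wbar] lewis_run_iterate[OF assms, of 0] by blast
  have "wbar $ i * ln (wbar $ i / ?w i) \<le> wbar $ i * (real m / real n)" if i: "i < m" for i
  proof (rule mult_left_mono)
    have "ln (wbar $ i / ?w i) \<le> wbar $ i / ?w i"
      using ln_le_minus_one[of "wbar $ i / ?w i"] pos[OF i] w[OF i] assms(5,6) by simp
    also have "\<dots> \<le> real m / real n"
      unfolding w[OF i] using lewis_weights_le_1[OF A rank wbar i] pos[OF i] assms(5,6)
      by (simp add: divide_simps mult_left_le_one_le)
    finally show "ln (wbar $ i / ?w i) \<le> real m / real n" .
  qed (use pos[OF i] in simp)
  then have "kl m (\<lambda>i. wbar $ i) ?w \<le> (\<Sum>i<m. wbar $ i * (real m / real n))"
    unfolding kl_def by (intro sum_mono) auto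
  also have "\<dots> = real m"
    unfolding sum_distrib_right[symmetric] lewis_step.sum_wbar[OF step] using assms(5) by simp
  finally show ?case by simp
next
  case (Suc t)
  let ?w = "fst (lewis_run A p t)"
  obtain c l where step: "lewis_step m n (1 - 2 / p) (\<lambda>i. wbar $ i) (\<lambda>i. ?w $ i)
      (\<lambda>i. leverage_scores (lewis_rescale A p ?w) $ i) c l"
    using lewis_step_exists[OF A rank p wbar] lewis_run_iterate[OF assms, of t] by blast
  have "kl m (\<lambda>i. wbar $ i) (\<lambda>i. fst (lewis_run A p (Suc t)) $ i)
      \<le> (1 - 2 / p) * kl m (\<lambda>i. wbar $ i) (\<lambda>i. ?w $ i)"
    unfolding fst_lewis_run_Suc
    using lewis_step.kl_contraction[OF step] lewis_step.gap_nonneg[OF step] by linarith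
  also have "\<dots> \<le> (1 - 2 / p) * ((1 - 2 / p) ^ t * real m)"
    by (rule mult_left_mono[OF Suc]) (use p in simp)
  finally show ?case by (simp only: power_Suc mult.assoc)
qed

text \<open>Dividing iterate \<open>N\<close> by the power of iterate \<open>t = N - 1\<close>
  leaves exactly \<open>tau\<close> at iterate \<open>t\<close>, so
  \<open>q = tau powr (p/2)\<close> is to be compared with
  \<open>wbar = taubar powr (p/2)\<close>.\<close>

lemma lewis_fixed_point_accuracy:
  assumes A: "A \<in> carrier_mat m n" and rank: "full_column_rank A" and p: "2 < p"
    and wbar: "is_lewis_weights A p wbar" and mn: "0 < n" "0 < m"
    and eps: "0 < \<epsilon>" "\<epsilon> < 1"
    and N: "N = Suc t" "p * ln (8 * p * sqrt (real m) / \<epsilon>) \<le> real N" and i: "i < m"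
  defines "q \<equiv> (fst (lewis_run A p N) $ i / (fst (lewis_run A p t) $ i) powr (1 - 2/p)) powr (p/2)"
  shows "0 < q \<and> (1 - \<epsilon>) * wbar $ i \<le> q \<and> q \<le> (1 + \<epsilon>) * wbar $ i"
proof -
  let ?w = "fst (lewis_run A p t)"
  \<comment> \<open>The power \<open>p/2\<close> turns the factor \<open>exp (2 * d)\<close> of
    \<open>tau_bounds\<close> into \<open>exp (\<epsilon> / 8)\<close>. The \<open>8 * p\<close> in
    the iteration count matches this choice.\<close>
  define d where "d = \<epsilon> / (8 * p)"
  define a where "a = 1 - 2 / p"
  have a: "0 < a" using p by (simp add: a_def)
  obtain c l where "lewis_step m n (1 - 2 / p) (\<lambda>i. wbar $ i) (\<lambda>i. ?w $ i)
      (\<lambda>i. leverage_scores (lewis_rescale A p ?w) $ i) c l"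
    using lewis_step_exists[OF A rank p wbar] lewis_run_iterate[OF A rank p wbar mn, of t] by blast
  then interpret lewis_step m n a "\<lambda>i. wbar $ i" "\<lambda>i. ?w $ i"
      "\<lambda>i. leverage_scores (lewis_rescale A p ?w) $ i" c l unfolding a_def .
  have X: "0 < 8 * p * sqrt (real m) / \<epsilon>" using p mn eps by simp
  \<comment> \<open>With \<open>X = 8 p sqrt m / \<epsilon>\<close>: from
    \<open>1 - 2/p \<le> exp (-2/p)\<close> and \<open>N \<ge> p ln X\<close> follows
    \<open>a^N \<le> X^-2 = d^2 / m\<close>.\<close>
  have "a ^ N \<le> exp (- 2 / p) ^ N"
    using a exp_ge_add_one_self[of "- 2 / p"] by (intro power_mono) (auto simp: a_def)
  also have "\<dots> = exp (- 2 / p * real N)" 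
    using exp_of_nat_mult[of N "- 2 / p"] by (simp only: mult.commute)
  also have "\<dots> \<le> exp (- 2 * ln (8 * p * sqrt (real m) / \<epsilon>))"
    using N(2) p by (simp add: field_simps)
  also have "\<dots> = 1 / (8 * p * sqrt (real m) / \<epsilon>)\<^sup>2"
    using X by (simp add: exp_minus exp_double field_simps)
  also have "\<dots> = d\<^sup>2 / real m"
    using mn by (simp add: d_def power_divide power_mult_distrib)
  finally have aN: "a ^ N \<le> d\<^sup>2 / real m" .
  \<comment> \<open>Only \<open>t = N - 1\<close> contractions precede this iterate; the missing
    factor \<open>a\<close> is the one in \<open>gap_le\<close>.\<close>
  have "a * kl m (\<lambda>i. wbar $ i) (\<lambda>i. ?w $ i) \<le> a * (a ^ t * real m)"
    using kl_lewis_run_le[OF A rank p wbar mn, of t] a by (intro mult_left_mono) (auto simp: a_def)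
  also have "\<dots> = a ^ N * real m" by (simp add: N)
  also have "\<dots> \<le> d\<^sup>2" using aN mn by (simp add: field_simps)
  finally have kl: "a * kl m (\<lambda>i. wbar $ i) (\<lambda>i. ?w $ i) \<le> d\<^sup>2" .
  have d: "0 \<le> d" "d \<le> 1" using eps p by (auto simp: d_def)
  have qt: "q = tau i powr (p / 2)"
    unfolding q_def N(1) fst_lewis_run_Suc step[OF i] using pos(2)[OF i]
    by (simp add: tau_def a_def)
  have wt: "wbar $ i = taubar i powr (p / 2)"
    using pos(1)[OF i] p by (simp add: taubar_powr[OF i] powr_powr a_def)
  have dp: "exp (2 * d) powr (p / 2) = exp (\<epsilon> / 8)" "exp (- 2 * d) powr (p / 2) = exp (- \<epsilon> / 8)"
    using p by (simp_all add: powr_def d_def)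
  have wpos: "0 < wbar $ i" by (rule pos(1)[OF i])
  have "q \<le> (exp (2 * d) * taubar i) powr (p / 2)"
    unfolding qt using tau_bounds(2)[OF kl d i] tau_pos[OF i] p by (intro powr_mono2) auto
  also have "\<dots> = exp (\<epsilon> / 8) * wbar $ i"
    using taubar_pos[OF i] by (simp add: powr_mult dp wt)
  also have "\<dots> \<le> (1 + \<epsilon>) * wbar $ i"
  proof (rule mult_right_mono)
    have "exp (\<epsilon> / 8) \<le> 1 + 2 * (\<epsilon> / 8)"
      using exp_bound_lemma[of "\<epsilon> / 8"] eps by simp
    then show "exp (\<epsilon> / 8) \<le> 1 + \<epsilon>" using eps by simp
  qed (use wpos in simp)
  finally have upper: "q \<le> (1 + \<epsilon>) * wbar $ i" .
  have "(1 - \<epsilon>) * wbar $ i \<le> exp (- \<epsilon> / 8) * wbar $ i"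
    using exp_ge_add_one_self[of "- \<epsilon> / 8"] eps wpos by (intro mult_right_mono) auto
  also have "\<dots> = (exp (- 2 * d) * taubar i) powr (p / 2)"
    using taubar_pos[OF i] dp(2) by (simp add: powr_mult wt)
  also have "\<dots> \<le> q"
    unfolding qt using tau_bounds(1)[OF kl d i] taubar_pos[OF i] p by (intro powr_mono2) auto
  finally have lower: "(1 - \<epsilon>) * wbar $ i \<le> q" .
  have "0 < q" unfolding qt using tau_pos[OF i] by simp
  then show ?thesis using upper lower by blast
qed

text \<open>For \<open>X = p sqrt m / \<epsilon> \<ge> 2\<close>,
  \<open>ln 8 = 3 ln 2 \<le> 3 ln X\<close> bounds the argument of the ceiling by
  \<open>4 p ln X\<close>. Rounding up adds at most 1, and \<open>1 \<le> p ln X\<close> since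
  \<open>p > 2\<close> and \<open>ln 2 \<ge> 1/2\<close>.\<close>

lemma iteration_count_le:
  assumes p: "2 < p" and m: "0 < m" and eps: "0 < \<epsilon>" "\<epsilon> < 1"
  shows "0 < nat \<lceil>p * ln (8 * p * sqrt (real m) / \<epsilon>)\<rceil>"
    "real (nat \<lceil>p * ln (8 * p * sqrt (real m) / \<epsilon>)\<rceil>) \<le> 5 * p * ln (p * sqrt (real m) / \<epsilon>)"
proof -
  define X where "X = p * sqrt (real m) / \<epsilon>"
  have "2 * 1 \<le> p * sqrt (real m)" using p m by (intro mult_mono) auto
  also have "\<dots> \<le> X" using p m eps by (simp add: X_def field_simps mult_left_le_one_le)
  finally have X: "2 \<le> X" by simp
  have ln2: "1 / 2 \<le> ln (2::real)" 
    using exp_bound_lemma[of "1 / 2 :: real"] by (subst ln_ge_iff) simp_all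
  have lnX: "ln 2 \<le> ln X" using X by simp
  have "8 * p * sqrt (real m) / \<epsilon> = 8 * X" by (simp add: X_def)
  moreover have "ln (8 * X) = ln 8 + ln X" using X by (intro ln_mult_pos) auto
  moreover have "ln (8::real) = 3 * ln 2" using ln_realpow[of "2::real" 3] by simp
  ultimately have 8: "ln (8 * p * sqrt (real m) / \<epsilon>) = 3 * ln 2 + ln X" by simp
  have pos: "0 < p * (3 * ln 2 + ln X)" using p lnX ln2 by (intro mult_pos_pos) auto
  show "0 < nat \<lceil>p * ln (8 * p * sqrt (real m) / \<epsilon>)\<rceil>" unfolding 8 using pos by simp
  have "2 * (1 / 2) \<le> p * ln X" using p lnX ln2 by (intro mult_mono) auto
  moreover have "p * (3 * ln 2 + ln X) \<le> p * (4 * ln X)" using p lnX by (intro mult_left_mono) auto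
  moreover have "real (nat \<lceil>p * (3 * ln 2 + ln X)\<rceil>) \<le> p * (3 * ln 2 + ln X) + 1" using pos by linarith
  ultimately show "real (nat \<lceil>p * ln (8 * p * sqrt (real m) / \<epsilon>)\<rceil>) \<le> 5 * p * ln (p * sqrt (real m) / \<epsilon>)"
    unfolding 8 X_def[symmetric] by (simp add: algebra_simps)
qed

theorem corollary1p4:
  "\<exists>C::real. C > 0 \<and>
     (\<forall>(m::nat) (n::nat) (A::real mat) (p::real) (wbar::real vec) (\<epsilon>::real).
        A \<in> carrier_mat m n \<longrightarrow>
        full_column_rank A \<longrightarrow>
        (\<forall>i<m. row A i \<noteq> 0\<^sub>v n) \<longrightarrow>
        p > 2 \<longrightarrow>
        is_lewis_weights A p wbar \<longrightarrow>
        0 < \<epsilon> \<longrightarrow> \<epsilon> < 1 \<longrightarrow>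
        (\<exists>(what::real vec) (iters::(real mat \<times> real vec) list).
           lewis_fixed_point A p \<epsilon> = (what, iters) \<and>
           what \<in> carrier_vec m \<and> positive_vec what \<and>
           (\<forall>i<m. (1 - \<epsilon>) * wbar $ i \<le> what $ i \<and> what $ i \<le> (1 + \<epsilon>) * wbar $ i) \<and>
           real (length iters) \<le> C * p * ln (p * sqrt (real m) / \<epsilon>) \<and>
           (\<forall>(B, s) \<in> set iters.
              \<exists>d \<in> carrier_vec m. positive_vec d \<and>
                B = diag_of_vec d * A \<and> s = leverage_scores B)))"
proof (intro exI[of _ 5] conjI allI impI)
  fix m n :: nat and A :: "real mat" and p \<epsilon> :: real and wbar :: "real vec"
  assume A: "A \<in> carrier_mat m n" and rank: "full_column_rank A"
    and rows: "\<forall>i<m. row A i \<noteq> 0\<^sub>v n" and p: "p > 2"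
    and wbar: "is_lewis_weights A p wbar" and eps: "0 < \<epsilon>" "\<epsilon> < 1"
  \<comment> \<open>Without columns every row would be a zero row.\<close>
  have n_pos: "0 < n" if "0 < m"
  proof (rule ccontr)
    assume "\<not> 0 < n"
    then have "row A 0 = 0\<^sub>v n" using A by (intro eq_vecI) auto
    then show False using rows that by blast
  qed
  define N where "N = nat \<lceil>p * ln (8 * p * sqrt (real m) / \<epsilon>)\<rceil>"
  show "\<exists>what iters. lewis_fixed_point A p \<epsilon> = (what, iters) \<and>
     what \<in> carrier_vec m \<and> positive_vec what \<and>
     (\<forall>i<m. (1 - \<epsilon>) * wbar $ i \<le> what $ i \<and> what $ i \<le> (1 + \<epsilon>) * wbar $ i) \<and>
     real (length iters) \<le> 5 * p * ln (p * sqrt (real m) / \<epsilon>) \<and>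
     (\<forall>(B, s) \<in> set iters. \<exists>d \<in> carrier_vec m. positive_vec d \<and>
        B = diag_of_vec d * A \<and> s = leverage_scores B)"
  proof (cases "m = n")
    case True
    \<comment> \<open>For \<open>m = n\<close> the weights are at most 1 and sum to
      \<open>m\<close>, so the algorithm's answer is exact.\<close>
    have "wbar $ i = 1" if i: "i < m" for i
    proof -
      have mn: "0 < m" "0 < n" using i True by auto
      obtain c l where step: "lewis_step m n (1 - 2 / p) (\<lambda>i. wbar $ i) (\<lambda>i. fst (lewis_run A p 0) $ i)
          (\<lambda>i. leverage_scores (lewis_rescale A p (fst (lewis_run A p 0))) $ i) c l"
        using lewis_step_exists[OF A rank p wbar] lewis_run_iterate[OF A rank p wbar mn(2,1), of 0] by blast
      have "(\<Sum>i<m. 1 - wbar $ i) = 0"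
        using lewis_step.sum_wbar[OF step] True by (simp add: sum_subtractf)
      then have "\<forall>i\<in>{..<m}. 1 - wbar $ i = 0"
        using lewis_weights_le_1[OF A rank wbar] by (subst (asm) sum_nonneg_eq_0_iff) auto
      then show ?thesis using i by simp
    qed
    \<comment> \<open>For \<open>m = 0\<close> the bound contains \<open>ln 0\<close>, whose value
      is 0.\<close>
    moreover have "0 \<le> 5 * p * ln (p * sqrt (real m) / \<epsilon>)"
      using iteration_count_le(2)[OF p _ eps, of m] by (cases "m = 0") (auto intro: order_trans[OF of_nat_0_le_iff])
    ultimately show ?thesis
      using A True eps by (simp add: lewis_fixed_point_def positive_vec_def)
  next
    case False
    \<comment> \<open>If \<open>m = 0\<close> and \<open>m\<close> differs from \<open>n\<close>,
      then \<open>n > 0\<close> and a unit vector lies in the kernel of \<open>A\<close>, against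
      full column rank.\<close>
    have m: "0 < m"
    proof (rule ccontr)
      assume "\<not> 0 < m"
      then have "m = 0" by simp
      have "unit_vec n 0 = (0\<^sub>v n :: real vec)"
        using \<open>m = 0\<close> A by (intro full_column_rank_kernel[OF A rank]) (auto intro!: eq_vecI)
      then have "unit_vec n 0 $ 0 = (0\<^sub>v n :: real vec) $ 0" by simp
      then show False using False \<open>m = 0\<close> by simp
    qed
    have n: "0 < n" by (rule n_pos[OF m])
    note count = iteration_count_le[OF p m eps, folded N_def]
    obtain t where t: "N = Suc t" using count(1) gr0_implies_Suc by blast
    have Nge: "p * ln (8 * p * sqrt (real m) / \<epsilon>) \<le> real N" unfolding N_def by linarith
    define what where "what = vec m (\<lambda>i. (fst (lewis_run A p N) $ i /
      (fst (lewis_run A p t) $ i) powr (1 - 2/p)) powr (p/2))"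
    have run: "lewis_fixed_point A p \<epsilon> = (what, snd (lewis_run A p N))"
      using A False t unfolding lewis_fixed_point_def Let_def
      by (simp add: N_def[symmetric] what_def case_prod_beta del: lewis_run.simps)
    show ?thesis
    proof (intro exI conjI)
      show "lewis_fixed_point A p \<epsilon> = (what, snd (lewis_run A p N))" by (rule run)
      show "what \<in> carrier_vec m" by (simp add: what_def)
      note acc = lewis_fixed_point_accuracy[OF A rank p wbar n m eps t Nge]
      show "positive_vec what" using acc by (simp add: what_def positive_vec_def)
      show "\<forall>i<m. (1 - \<epsilon>) * wbar $ i \<le> what $ i \<and> what $ i \<le> (1 + \<epsilon>) * wbar $ i"
        using acc by (simp add: what_def)
      show "real (length (snd (lewis_run A p N))) \<le> 5 * p * ln (p * sqrt (real m) / \<epsilon>)"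
        using count(2) by (simp add: length_lewis_run)
      show "\<forall>(B, s) \<in> set (snd (lewis_run A p N)). \<exists>d \<in> carrier_vec m. positive_vec d \<and>
          B = diag_of_vec d * A \<and> s = leverage_scores B"
        using lewis_run_log[OF A rank p wbar n m] by blast
    qed
  qed
qed simp

end
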